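(* Let $F_r$ be the free group of rank $r\ge 2$ and let $\theta:F_r\to F_r$ be an injective endomorphism. Let $\overline{\theta}:\mathbb{Z}^r\to\mathbb{Z}^r$ be the induced homomorphism of the abelianisation $F_r/[F_r,F_r]\cong\mathbb{Z}^r$, given by $\overline{\theta}(x[F_r,F_r])=\theta(x)[F_r,F_r]$. If $\det(\overline{\theta})\ne 0$ then the ascending HNN extension $F_r*_\theta$ is residually finite.
   Context: For a group $N=\langle X\mid R\rangle$ and an injective endomorphism $\theta:N\to N$ (not necessarily surjective), the ascending HNN extension $N*_\theta$ with stable letter $t$ is the group $\langle X,t\mid R,\ txt^{-1}=\theta(x)\ \forall x\in X\rangle$. *)

theory Defs
  imports "HOL-Algebra.Generated_Groups" "Jordan_Normal_Form.Determinant"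
begin

section \<open>Groups given by generators and relations\<close>

text \<open>The letter \<open>(x, True)\<close> stands for the generator \<open>x\<close>, and \<open>(x, False)\<close> for its formal inverse.\<close>

type_synonym 'a gword = "('a \<times> bool) list"

definition gwords :: "'a set \<Rightarrow> 'a gword set" where
  "gwords X = lists (X \<times> UNIV)"

text \<open>Equality of words in the group \<open>\<langle>X | R\<rangle>\<close>. A pair \<open>(u, v) \<in> R\<close> is the relation \<open>u = v\<close>;
  pairs that are not pairs of words over \<open>X\<close> are ignored.\<close>

inductive gword_eq :: "'a set \<Rightarrow> ('a gword \<times> 'a gword) set \<Rightarrow> 'a gword \<Rightarrow> 'a gword \<Rightarrow> bool"
  for X :: "'a set" and R :: "('a gword \<times> 'a gword) set" where
  refl: "u \<in> gwords X \<Longrightarrow> gword_eq X R u u"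
| sym: "gword_eq X R u v \<Longrightarrow> gword_eq X R v u"
| trans: "gword_eq X R u v \<Longrightarrow> gword_eq X R v w \<Longrightarrow> gword_eq X R u w"
| append: "gword_eq X R u v \<Longrightarrow> gword_eq X R u' v' \<Longrightarrow> gword_eq X R (u @ u') (v @ v')"
| cancel: "x \<in> X \<Longrightarrow> gword_eq X R [(x, b), (x, \<not> b)] []"
| relation: "(u, v) \<in> R \<Longrightarrow> u \<in> gwords X \<Longrightarrow> v \<in> gwords X \<Longrightarrow> gword_eq X R u v"

definition gword_class :: "'a set \<Rightarrow> ('a gword \<times> 'a gword) set \<Rightarrow> 'a gword \<Rightarrow> 'a gword set" where
  "gword_class X R u = {v. gword_eq X R u v}"

definition presented_group ::
  "'a set \<Rightarrow> ('a gword \<times> 'a gword) set \<Rightarrow> 'a gword set monoid" where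
  "presented_group X R =
    \<lparr> carrier = gword_class X R ` gwords X,
      monoid.mult = (\<lambda>A B. {w. \<exists>u\<in>A. \<exists>v\<in>B. gword_eq X R (u @ v) w}),
      one = gword_class X R [] \<rparr>"

lemma gword_eq_gwords: "gword_eq X R u v \<Longrightarrow> u \<in> gwords X \<and> v \<in> gwords X"
  by (induction rule: gword_eq.induct) (auto simp: gwords_def)

lemma gword_class_eq_iff:
  assumes "u \<in> gwords X"
  shows "gword_class X R u = gword_class X R v \<longleftrightarrow> gword_eq X R u v"
proof
  assume "gword_class X R u = gword_class X R v"
  then have "u \<in> gword_class X R v"
    using gword_eq.refl[OF assms] by (auto simp: gword_class_def)
  then show "gword_eq X R u v" by (auto simp: gword_class_def intro: gword_eq.sym)
next
  assume "gword_eq X R u v"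
  then show "gword_class X R u = gword_class X R v"
    unfolding gword_class_def using gword_eq.trans gword_eq.sym by blast
qed

lemma carrier_presented_group: "carrier (presented_group X R) = gword_class X R ` gwords X"
  by (simp add: presented_group_def)

lemma one_presented_group: "\<one>\<^bsub>presented_group X R\<^esub> = gword_class X R []"
  by (simp add: presented_group_def)

lemma mult_presented_group:
  assumes "u \<in> gwords X" "v \<in> gwords X"
  shows "gword_class X R u \<otimes>\<^bsub>presented_group X R\<^esub> gword_class X R v = gword_class X R (u @ v)"
proof -
  have "(\<exists>u'. gword_eq X R u u' \<and> (\<exists>v'. gword_eq X R v v' \<and> gword_eq X R (u' @ v') w)) \<longleftrightarrow>
      gword_eq X R (u @ v) w" for w
  proof
    assume "\<exists>u'. gword_eq X R u u' \<and> (\<exists>v'. gword_eq X R v v' \<and> gword_eq X R (u' @ v') w)"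
    then obtain u' v' where "gword_eq X R u u'" "gword_eq X R v v'" "gword_eq X R (u' @ v') w"
      by blast
    then show "gword_eq X R (u @ v) w"
      using gword_eq.trans[OF gword_eq.append] by blast
  qed (use assms gword_eq.refl in blast)
  then show ?thesis
    by (simp add: presented_group_def gword_class_def)
qed

lemma gword_inverse:
  assumes "u \<in> gwords X"
  obtains v where "v \<in> gwords X" "gword_eq X R (v @ u) []"
proof -
  have "\<exists>v. v \<in> gwords X \<and> gword_eq X R (v @ u) []"
    using assms
  proof (induction u)
    case Nil
    have "([] :: 'a gword) \<in> gwords X" by (simp add: gwords_def)
    then show ?case using gword_eq.refl by fastforce
  next
    case (Cons a u)
    obtain x b where a: "a = (x, b)" by (cases a)
    have xu: "x \<in> X" "u \<in> gwords X" using Cons.prems by (auto simp: gwords_def a)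
    then obtain v where v: "v \<in> gwords X" "gword_eq X R (v @ u) []" using Cons.IH by blast
    have "gword_eq X R (v @ ([(x, \<not> b), (x, b)] @ u)) (v @ ([] @ u))"
      using gword_eq.cancel[of x X R "\<not> b"] xu v by (intro gword_eq.append gword_eq.refl) auto
    then have "gword_eq X R ((v @ [(x, \<not> b)]) @ a # u) []"
      using v(2) gword_eq.trans by (fastforce simp: a)
    moreover have "v @ [(x, \<not> b)] \<in> gwords X" using v(1) xu by (auto simp: gwords_def)
    ultimately show ?case by blast
  qed
  then show thesis using that by blast
qed

lemma group_presented_group: "group (presented_group X R)"
proof (rule groupI)
  have app: "u @ v \<in> gwords X" if "u \<in> gwords X" "v \<in> gwords X" for u v :: "'a gword"
    using that by (auto simp: gwords_def)
  have nil: "[] \<in> gwords X" by (simp add: gwords_def)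
  show "\<one>\<^bsub>presented_group X R\<^esub> \<in> carrier (presented_group X R)"
    using nil by (simp add: carrier_presented_group one_presented_group)
  show "A \<otimes>\<^bsub>presented_group X R\<^esub> B \<in> carrier (presented_group X R)"
    if "A \<in> carrier (presented_group X R)" "B \<in> carrier (presented_group X R)" for A B
    using that app by (auto simp: carrier_presented_group mult_presented_group)
  show "A \<otimes>\<^bsub>presented_group X R\<^esub> B \<otimes>\<^bsub>presented_group X R\<^esub> C =
      A \<otimes>\<^bsub>presented_group X R\<^esub> (B \<otimes>\<^bsub>presented_group X R\<^esub> C)"
    if "A \<in> carrier (presented_group X R)" "B \<in> carrier (presented_group X R)"
      "C \<in> carrier (presented_group X R)" for A B C
    using that app by (auto simp: carrier_presented_group mult_presented_group)
  show "\<one>\<^bsub>presented_group X R\<^esub> \<otimes>\<^bsub>presented_group X R\<^esub> A = A"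
    if "A \<in> carrier (presented_group X R)" for A
    using that nil by (auto simp: carrier_presented_group one_presented_group mult_presented_group)
  show "\<exists>B\<in>carrier (presented_group X R). B \<otimes>\<^bsub>presented_group X R\<^esub> A = \<one>\<^bsub>presented_group X R\<^esub>"
    if A: "A \<in> carrier (presented_group X R)" for A
  proof -
    obtain u where u: "u \<in> gwords X" "A = gword_class X R u"
      using A by (auto simp: carrier_presented_group)
    obtain v where v: "v \<in> gwords X" "gword_eq X R (v @ u) []"
      using gword_inverse[OF u(1)] by blast
    have "gword_class X R v \<otimes>\<^bsub>presented_group X R\<^esub> A = \<one>\<^bsub>presented_group X R\<^esub>"
      using u v app by (simp add: mult_presented_group one_presented_group gword_class_eq_iff)
    then show ?thesis using v(1) by (auto simp: carrier_presented_group)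
  qed
qed

definition free_group :: "nat \<Rightarrow> nat gword set monoid" where
  "free_group r = presented_group {..<r} {}"

section \<open>Ascending HNN extensions\<close>

text \<open>The stable letter is \<open>None\<close>; the old generator \<open>x\<close> becomes \<open>Some x\<close>. In the relation
  \<open>t x t\<^sup>-\<^sup>1 = \<theta>(x)\<close> the right-hand side ranges over all words representing the element \<open>\<theta>(x)\<close> of
  \<open>\<langle>X | R\<rangle>\<close>, which are equal modulo \<open>R\<close>.\<close>

definition lift_gword :: "'a gword \<Rightarrow> 'a option gword" where
  "lift_gword = map (map_prod Some id)"

definition ascending_HNN ::
  "'a set \<Rightarrow> ('a gword \<times> 'a gword) set \<Rightarrow> ('a gword set \<Rightarrow> 'a gword set) \<Rightarrow>
    'a option gword set monoid" where
  "ascending_HNN X R \<theta> =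
    presented_group (insert None (Some ` X))
      ({(lift_gword u, lift_gword v) | u v. (u, v) \<in> R} \<union>
       {([(None, True), (Some x, True), (None, False)], lift_gword w) | x w.
          x \<in> X \<and> w \<in> \<theta> (gword_class X R [(x, True)])})"

section \<open>Residual finiteness\<close>

definition residually_finite :: "('a, 'b) monoid_scheme \<Rightarrow> bool" where
  "residually_finite G \<longleftrightarrow>
    (\<forall>g\<in>carrier G. g \<noteq> \<one>\<^bsub>G\<^esub> \<longrightarrow> (\<exists>N. N \<lhd> G \<and> finite (carrier (G Mod N)) \<and> g \<notin> N))"

section \<open>The abelianisation and the induced endomorphism\<close>

definition abelianisation :: "('a, 'b) monoid_scheme \<Rightarrow> 'a set monoid" where
  "abelianisation G = G Mod derived G (carrier G)"

definition induced_endo :: "('a, 'b) monoid_scheme \<Rightarrow> ('a \<Rightarrow> 'a) \<Rightarrow> 'a set \<Rightarrow> 'a set" where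
  "induced_endo G \<theta> C = (\<Union>x\<in>C. derived G (carrier G) #>\<^bsub>G\<^esub> \<theta> x)"

lemma induced_endo_coset:
  assumes "group G" "\<theta> \<in> hom G G" "x \<in> carrier G"
  shows "induced_endo G \<theta> (derived G (carrier G) #>\<^bsub>G\<^esub> x) = derived G (carrier G) #>\<^bsub>G\<^esub> \<theta> x"
proof -
  interpret group_hom G G \<theta>
    using assms by (simp add: group_hom_def group_hom_axioms_def)
  let ?D = "derived G (carrier G)"
  have sub: "subgroup ?D G"
    by (rule G.derived_is_subgroup) simp
  have "\<theta> ` carrier G \<subseteq> carrier G"
    using hom_closed by blast
  then have "\<theta> ` ?D \<subseteq> ?D"
    using derived_img[OF order.refl] G.mono_derived by metis
  then have img: "\<theta> d \<in> ?D" if "d \<in> ?D" for d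
    using that by blast
  have coset: "?D #>\<^bsub>G\<^esub> \<theta> y = ?D #>\<^bsub>G\<^esub> \<theta> x" if y: "y \<in> ?D #>\<^bsub>G\<^esub> x" for y
  proof -
    obtain d where d: "d \<in> ?D" "y = d \<otimes>\<^bsub>G\<^esub> x" using y by (auto simp: r_coset_def)
    have "\<theta> y = \<theta> d \<otimes>\<^bsub>G\<^esub> \<theta> x"
      using d subgroup.mem_carrier[OF sub] assms(3) by simp
    then have "\<theta> y \<in> ?D #>\<^bsub>G\<^esub> \<theta> x" using img d by (auto simp: r_coset_def)
    then show ?thesis
      using G.repr_independence[OF _ hom_closed[OF assms(3)] sub] by simp
  qed
  have "x \<in> ?D #>\<^bsub>G\<^esub> x" by (rule G.rcos_self[OF assms(3) sub])
  then show ?thesis using coset unfolding induced_endo_def by blast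
qed

text \<open>For an isomorphism \<open>\<phi>\<close> from the abelianisation of \<open>G\<close> to \<open>\<int>\<^sup>r\<close>, the endomorphism of \<open>\<int>\<^sup>r\<close>
  induced by \<open>\<theta>\<close>, and the matrix whose columns are the images of the standard basis vectors.\<close>

definition induced_on_Zr ::
  "('a, 'b) monoid_scheme \<Rightarrow> ('a set \<Rightarrow> int vec) \<Rightarrow> ('a \<Rightarrow> 'a) \<Rightarrow> int vec \<Rightarrow> int vec" where
  "induced_on_Zr G \<phi> \<theta> v = \<phi> (induced_endo G \<theta> (inv_into (carrier (abelianisation G)) \<phi> v))"

definition endo_matrix :: "nat \<Rightarrow> (int vec \<Rightarrow> int vec) \<Rightarrow> int mat" where
  "endo_matrix r f = mat_of_cols r (map (\<lambda>j. f (unit_vec r j)) [0..<r])"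

text \<open>The abelianisation of the free group of rank \<open>r\<close> is isomorphic to \<open>\<int>\<^sup>r\<close>, via exponent sums.\<close>

definition expo :: "nat \<Rightarrow> nat gword \<Rightarrow> int vec" where
  "expo r w = vec r (\<lambda>i. \<Sum>(x, b)\<leftarrow>w. if x = i then (if b then 1 else - 1) else 0)"

lemma expo_carrier [simp]: "expo r w \<in> carrier_vec r"
  by (simp add: expo_def)

lemma expo_append: "expo r (u @ v) = expo r u + expo r v"
  by (rule eq_vecI) (auto simp: expo_def)

lemma expo_gword_eq: "gword_eq X {} u v \<Longrightarrow> expo r u = expo r v"
proof (induction rule: gword_eq.induct)
  case (append u v u' v')
  then show ?case by (simp add: expo_append)
next
  case (cancel x b)
  show ?case by (rule eq_vecI) (auto simp: expo_def)
qed auto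

lemma expo_surj:
  assumes "v \<in> carrier_vec r"
  obtains w where "w \<in> gwords {..<r}" "expo r w = v"
proof
  define f where "f = (\<lambda>i. replicate (nat \<bar>v $ i\<bar>) (i, v $ i \<ge> 0))"
  let ?w = "concat (map f [0..<r])"
  show "?w \<in> gwords {..<r}" by (auto simp: gwords_def f_def)
  let ?g = "\<lambda>i (x, b). if x = i then (if b then 1 else - 1) else (0::int)"
  have one: "sum_list (map (?g i) (f j)) = (if j = i then v $ i else 0)" for i j
    by (auto simp: f_def sum_list_replicate)
  have "sum_list (map (?g i) (concat (map f [0..<n]))) = (if i < n then v $ i else 0)" for i n
    by (induction n) (auto simp: one)
  then show "expo r ?w = v"
    using assms by (intro eq_vecI) (auto simp: expo_def)
qed

lemma comm_group_monoid_vec: "comm_group (monoid_vec TYPE(int) r)"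
proof (rule comm_groupI)
  show "\<exists>y\<in>carrier (monoid_vec TYPE(int) r).
      y \<otimes>\<^bsub>monoid_vec TYPE(int) r\<^esub> x = \<one>\<^bsub>monoid_vec TYPE(int) r\<^esub>"
    if "x \<in> carrier (monoid_vec TYPE(int) r)" for x
    using that by (intro bexI[of _ "- x"]) (auto simp: monoid_vec_simps)
qed (auto simp: monoid_vec_simps intro: comm_add_vec)

lemma abelianisation_free_group_iso:
  "\<exists>\<phi>. \<phi> \<in> iso (abelianisation (free_group r)) (monoid_vec TYPE(int) r)"
proof -
  let ?X = "{..<r}"
  let ?F = "free_group r" and ?Z = "monoid_vec TYPE(int) r"
  let ?c = "gword_class ?X {}"
  let ?D = "derived ?F (carrier ?F)"
  let ?A = "abelianisation ?F"
  interpret F: group ?F unfolding free_group_def by (rule group_presented_group)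
  interpret Z: comm_group ?Z by (rule comm_group_monoid_vec)
  interpret A: comm_group ?A unfolding abelianisation_def by (rule F.derived_quot_is_comm_group)
  have nD: "?D \<lhd> ?F" by (rule F.derived_self_is_normal)
  have sD: "subgroup ?D ?F" using nD by (rule normal_imp_subgroup)
  have carF: "carrier ?F = ?c ` gwords ?X" by (simp add: free_group_def carrier_presented_group)
  have mulF: "?c u \<otimes>\<^bsub>?F\<^esub> ?c v = ?c (u @ v)" if "u \<in> gwords ?X" "v \<in> gwords ?X" for u v
    using that by (simp add: free_group_def mult_presented_group)
  have oneF: "\<one>\<^bsub>?F\<^esub> = ?c []" by (simp add: free_group_def one_presented_group)
  define h where "h C = expo r (SOME u. u \<in> C)" for C
  have h: "h (?c u) = expo r u" if "u \<in> gwords ?X" for u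
  proof -
    have "u \<in> ?c u" using gword_eq.refl[OF that] by (simp add: gword_class_def)
    then have "(SOME v. v \<in> ?c u) \<in> ?c u" by (rule someI)
    then have "gword_eq ?X {} u (SOME v. v \<in> ?c u)" by (simp add: gword_class_def)
    then show ?thesis unfolding h_def by (simp add: expo_gword_eq)
  qed
  have app: "u @ v \<in> gwords ?X" if "u \<in> gwords ?X" "v \<in> gwords ?X" for u v
    using that by (auto simp: gwords_def)
  have "h \<in> hom ?F ?Z"
    by (rule homI) (auto simp: carF mulF h app expo_append monoid_vec_simps)
  then interpret h: group_hom ?F ?Z h
    by (simp add: group_hom_def group_hom_axioms_def F.group_axioms Z.group_axioms)
  have surj: "h ` carrier ?F = carrier ?Z"
  proof
    show "carrier ?Z \<subseteq> h ` carrier ?F"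
    proof
      fix v assume "v \<in> carrier ?Z"
      then obtain w where "w \<in> gwords ?X" "expo r w = v"
        using expo_surj[of v r] unfolding monoid_vec_simps by blast
      then show "v \<in> h ` carrier ?F" unfolding carF using h by (metis imageI)
    qed
  qed (rule image_subsetI, rule h.hom_closed)
  have DK: "?D \<subseteq> kernel ?F ?Z h"
    unfolding derived_def
  proof (rule F.generate_subgroup_incl[OF _ h.subgroup_kernel], rule subsetI)
    fix g assume "g \<in> derived_set ?F (carrier ?F)"
    then obtain a b where ab: "a \<in> carrier ?F" "b \<in> carrier ?F"
      "g = a \<otimes>\<^bsub>?F\<^esub> b \<otimes>\<^bsub>?F\<^esub> inv\<^bsub>?F\<^esub> a \<otimes>\<^bsub>?F\<^esub> inv\<^bsub>?F\<^esub> b" by auto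
    have "h g = h a \<otimes>\<^bsub>?Z\<^esub> h b \<otimes>\<^bsub>?Z\<^esub> inv\<^bsub>?Z\<^esub> h a \<otimes>\<^bsub>?Z\<^esub> inv\<^bsub>?Z\<^esub> h b"
      using ab by simp
    also have "\<dots> = h b \<otimes>\<^bsub>?Z\<^esub> h a \<otimes>\<^bsub>?Z\<^esub> inv\<^bsub>?Z\<^esub> h a \<otimes>\<^bsub>?Z\<^esub> inv\<^bsub>?Z\<^esub> h b"
      using Z.m_comm[of "h a" "h b"] ab by simp
    also have "\<dots> = h b \<otimes>\<^bsub>?Z\<^esub> (h a \<otimes>\<^bsub>?Z\<^esub> inv\<^bsub>?Z\<^esub> h a) \<otimes>\<^bsub>?Z\<^esub> inv\<^bsub>?Z\<^esub> h b"
      using ab by (subst Z.m_assoc[of "h b" "h a"]) auto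
    also have "\<dots> = \<one>\<^bsub>?Z\<^esub>" using ab by simp
    finally show "g \<in> kernel ?F ?Z h" using ab by (simp add: kernel_def)
  qed
  define q where "q C = ?D #>\<^bsub>?F\<^esub> C" for C
  have q: "q \<in> hom ?F ?A"
    unfolding q_def abelianisation_def by (rule normal.r_coset_hom_Mod[OF nD])
  interpret q: group_hom ?F ?A q
    using q by (simp add: group_hom_def group_hom_axioms_def F.group_axioms A.group_axioms)
  define g where "g i = q (?c [(i, True)])" for i
  have lt: "[(i, b)] \<in> gwords ?X" if "i < r" for i b using that by (simp add: gwords_def)
  have gA: "g i \<in> carrier ?A" if "i < r" for i
    unfolding g_def using lt[OF that] by (intro q.hom_closed) (auto simp: carF)
  have ginv: "q (?c [(i, False)]) = inv\<^bsub>?A\<^esub> g i" if "i < r" for i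
  proof -
    have "?c [(i, False)] \<otimes>\<^bsub>?F\<^esub> ?c [(i, True)] = \<one>\<^bsub>?F\<^esub>"
      using gword_eq.cancel[of i ?X "{}" False] lt[OF that] that
      by (simp add: mulF oneF gword_class_eq_iff gwords_def)
    then have "q (?c [(i, False)]) \<otimes>\<^bsub>?A\<^esub> g i = \<one>\<^bsub>?A\<^esub>"
      unfolding g_def using lt[OF that] q.hom_mult[of "?c [(i, False)]" "?c [(i, True)]"] q.hom_one
      by (simp add: carF)
    then show ?thesis
      using A.inv_equality gA[OF that] q.hom_closed lt[OF that] carF by (metis imageI)
  qed
  have qw: "q (?c u) = (\<Otimes>\<^bsub>?A\<^esub>i\<in>?X. g i [^]\<^bsub>?A\<^esub> (expo r u $ i))" if "u \<in> gwords ?X" for u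
    using that
  proof (induction u)
    case Nil
    have "q (?c []) = \<one>\<^bsub>?A\<^esub>" using q.hom_one by (simp add: oneF)
    also have "\<dots> = (\<Otimes>\<^bsub>?A\<^esub>i\<in>?X. g i [^]\<^bsub>?A\<^esub> (expo r [] $ i))"
      by (rule A.finprod_one_eqI[symmetric]) (simp add: expo_def)
    finally show ?case .
  next
    case (Cons a u)
    obtain x b where a: "a = (x, b)" by (cases a)
    have x: "x < r" and u: "u \<in> gwords ?X" using Cons.prems by (auto simp: gwords_def a)
    have l: "q (?c [a]) = (\<Otimes>\<^bsub>?A\<^esub>i\<in>?X. if x = i then g x [^]\<^bsub>?A\<^esub> (if b then 1 else - 1 :: int) else \<one>\<^bsub>?A\<^esub>)"
      using x gA[OF x] ginv[OF x]
      by (subst A.finprod_singleton) (auto simp: a g_def A.int_pow_neg A.int_pow_1)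
    have "q (?c (a # u)) = q (?c [a]) \<otimes>\<^bsub>?A\<^esub> q (?c u)"
      using mulF[OF lt[OF x] u, of b] q.hom_mult[of "?c [a]" "?c u"] lt[OF x] u by (simp add: a carF)
    also have "\<dots> = (\<Otimes>\<^bsub>?A\<^esub>i\<in>?X. (if x = i then g x [^]\<^bsub>?A\<^esub> (if b then 1 else - 1 :: int) else \<one>\<^bsub>?A\<^esub>)
        \<otimes>\<^bsub>?A\<^esub> g i [^]\<^bsub>?A\<^esub> (expo r u $ i))"
      unfolding l Cons.IH[OF u] using gA x by (subst A.finprod_multf) auto
    also have "\<dots> = (\<Otimes>\<^bsub>?A\<^esub>i\<in>?X. g i [^]\<^bsub>?A\<^esub> (expo r (a # u) $ i))"
      using gA x by (intro A.finprod_cong) (auto simp: a expo_def A.int_pow_mult simp_implies_def)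
    finally show ?case .
  qed
  have KD: "kernel ?F ?Z h \<subseteq> ?D"
  proof
    fix C assume "C \<in> kernel ?F ?Z h"
    then obtain u where u: "u \<in> gwords ?X" "C = ?c u" "expo r u = 0\<^sub>v r"
      by (auto simp: kernel_def carF h monoid_vec_simps)
    have "q C = \<one>\<^bsub>?A\<^esub>"
      unfolding u(2) qw[OF u(1)] by (rule A.finprod_one_eqI) (simp add: u(3))
    then have "?D #>\<^bsub>?F\<^esub> C = ?D" by (simp add: q_def abelianisation_def)
    moreover have "C \<in> ?D #>\<^bsub>?F\<^esub> C" using u(1) by (intro F.rcos_self sD) (simp add: carF u(2))
    ultimately show "C \<in> ?D" by simp
  qed
  have "(\<lambda>C. the_elem (h ` C)) \<in> iso (?F Mod kernel ?F ?Z h) ?Z"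
    by (rule h.FactGroup_iso_set[OF surj])
  moreover have "kernel ?F ?Z h = ?D" using DK KD by (rule subset_antisym[rotated])
  ultimately show ?thesis unfolding abelianisation_def by auto
qed

end

theory Submission
  imports Defs "HOL-Algebra.Elementary_Groups" "HOL-Algebra.Bij" "HOL-Number_Theory.Cong"
begin

text \<open>
  Choose a prime \<open>p\<close> not dividing the determinant. Precomposition with \<open>\<theta>\<close> acts on the finite set of
  homomorphisms \<open>F\<^sub>r \<rightarrow> U\<close>, where \<open>U\<close> is a group of unitriangular matrices modulo \<open>p\<close>. Comparing two
  homomorphisms subdiagonal by subdiagonal reduces the injectivity of this action to that of the
  transpose of \<open>\<theta>\<close> modulo \<open>p\<close> on the abelianisation; hence it is a permutation. The HNN extension
  therefore acts on the finite set \<open>U \<times> Hom(F\<^sub>r, U)\<close>, with \<open>t\<close> acting as the inverse of this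
  permutation. Every element has the form \<open>t\<^sup>-\<^sup>n u t\<^sup>m\<close> with \<open>u\<close> in the free group: if \<open>n \<noteq> m\<close> it
  survives in a finite cyclic quotient, and if \<open>n = m\<close> it suffices that \<open>u\<close> survives in \<open>U\<close>, which
  holds for \<open>p\<close> larger than the length of \<open>u\<close>.
\<close>

section \<open>Evaluation of words and homomorphisms out of a presented group\<close>

primrec wordval :: "('h, 'm) monoid_scheme \<Rightarrow> ('a \<Rightarrow> 'h) \<Rightarrow> 'a gword \<Rightarrow> 'h" where
  "wordval H f [] = \<one>\<^bsub>H\<^esub>"
| "wordval H f (a # w) =
    (if snd a then f (fst a) else inv\<^bsub>H\<^esub> f (fst a)) \<otimes>\<^bsub>H\<^esub> wordval H f w"

lemma gwords_simps [simp]: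
  "[] \<in> gwords X"
  "a # u \<in> gwords X \<longleftrightarrow> fst a \<in> X \<and> u \<in> gwords X"
  "u @ v \<in> gwords X \<longleftrightarrow> u \<in> gwords X \<and> v \<in> gwords X"
  by (auto simp: gwords_def mem_Times_iff)

context group
begin

lemma wordval_closed [simp]:
  "f \<in> X \<rightarrow> carrier G \<Longrightarrow> u \<in> gwords X \<Longrightarrow> wordval G f u \<in> carrier G"
  by (induction u) auto

lemma wordval_append:
  "f \<in> X \<rightarrow> carrier G \<Longrightarrow> u \<in> gwords X \<Longrightarrow> v \<in> gwords X \<Longrightarrow>
    wordval G f (u @ v) = wordval G f u \<otimes> wordval G f v"
proof (induction u)
  case (Cons a u)
  moreover have "f (fst a) \<in> carrier G" "wordval G f u \<in> carrier G" "wordval G f v \<in> carrier G"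
    using Cons.prems by auto
  ultimately show ?case by (auto simp: m_assoc)
qed auto

lemma wordval_gword_eq:
  assumes "gword_eq X R u v" "f \<in> X \<rightarrow> carrier G"
    and "\<And>u v. (u, v) \<in> R \<Longrightarrow> u \<in> gwords X \<Longrightarrow> v \<in> gwords X \<Longrightarrow> wordval G f u = wordval G f v"
  shows "wordval G f u = wordval G f v"
  using assms(1)
proof (induction rule: gword_eq.induct)
  case (append u v u' v')
  then show ?case using gword_eq_gwords assms(2) wordval_append by metis
next
  case (cancel x b)
  then have "f x \<in> carrier G" using assms(2) by auto
  then show ?case by auto
qed (use assms(3) in auto)

text \<open>Von Dyck's theorem: evaluation respects the relations, so it may be computed on any
  representative of a class; \<open>SOME\<close> picks one.\<close>

lemma presented_hom:
  assumes f: "f \<in> X \<rightarrow> carrier G"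
    and R: "\<And>u v. (u, v) \<in> R \<Longrightarrow> u \<in> gwords X \<Longrightarrow> v \<in> gwords X \<Longrightarrow> wordval G f u = wordval G f v"
  obtains h where "h \<in> hom (presented_group X R) G"
    "\<And>u. u \<in> gwords X \<Longrightarrow> h (gword_class X R u) = wordval G f u"
proof
  define h where "h C = wordval G f (SOME u. u \<in> C)" for C
  show h: "h (gword_class X R u) = wordval G f u" if "u \<in> gwords X" for u
  proof -
    have "u \<in> gword_class X R u" using gword_eq.refl[OF that] by (simp add: gword_class_def)
    then have "(SOME v. v \<in> gword_class X R u) \<in> gword_class X R u" by (rule someI)
    then have "gword_eq X R u (SOME v. v \<in> gword_class X R u)" by (simp add: gword_class_def)
    then show ?thesis unfolding h_def using wordval_gword_eq[OF _ f R] by metis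
  qed
  show "h \<in> hom (presented_group X R) G"
    by (rule homI)
      (auto simp: carrier_presented_group mult_presented_group h f wordval_append[OF f] intro: wordval_closed[OF f])
qed

end

text \<open>A homomorphism is determined by the images of the generators. Applied to the identity
  map, this identifies evaluation in the presented group itself with passing to classes.\<close>

lemma hom_presented_wordval:
  assumes "group H" "h \<in> hom (presented_group X R) H" "u \<in> gwords X"
  shows "h (gword_class X R u) = wordval H (\<lambda>x. h (gword_class X R [(x, True)])) u"
  using assms(3)
proof (induction u)
  case Nil
  then show ?case
    using hom_one[OF assms(2) group_presented_group assms(1)] by (simp add: one_presented_group)
next
  case (Cons a u)
  interpret h: group_hom "presented_group X R" H h
    using assms by (simp add: group_hom_def group_hom_axioms_def group_presented_group)
  obtain x b where a: "a = (x, b)" by (cases a)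
  have x: "x \<in> X" and u: "u \<in> gwords X" using Cons.prems by (auto simp: a)
  let ?c = "gword_class X R"
  have c: "?c w \<in> carrier (presented_group X R)" if "w \<in> gwords X" for w
    using that by (simp add: carrier_presented_group)
  have "?c [(x, False), (x, True)] = ?c []"
    using x gword_eq.cancel[OF x, of R False] by (simp add: gword_class_eq_iff)
  then have "h (?c [(x, False)]) \<otimes>\<^bsub>H\<^esub> h (?c [(x, True)]) = \<one>\<^bsub>H\<^esub>"
    using x c by (simp add: mult_presented_group one_presented_group flip: h.hom_mult h.hom_one)
  then have "h (?c [(x, False)]) = inv\<^bsub>H\<^esub> h (?c [(x, True)])"
    using c x h.H.inv_equality by (metis gwords_simps(1,2) fst_conv h.hom_closed)
  moreover have "h (?c (a # u)) = h (?c [a]) \<otimes>\<^bsub>H\<^esub> h (?c u)"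
    using x u c[of u] c[of "[a]"] by (simp add: a mult_presented_group flip: h.hom_mult)
  ultimately show ?case using Cons.IH[OF u] by (auto simp: a)
qed

text \<open>Von Dyck's theorem gives a homomorphism to the finite group \<open>H\<close>. Its kernel
  serves as \<open>N\<close>, because the quotient by it embeds in \<open>H\<close>.\<close>

lemma presented_group_separate:
  assumes H: "group H" "finite (carrier H)"
    and f: "f \<in> X \<rightarrow> carrier H"
    and R: "\<And>u v. (u, v) \<in> R \<Longrightarrow> u \<in> gwords X \<Longrightarrow> v \<in> gwords X \<Longrightarrow> wordval H f u = wordval H f v"
    and w: "w \<in> gwords X" "wordval H f w \<noteq> \<one>\<^bsub>H\<^esub>"
  shows "\<exists>N. N \<lhd> presented_group X R \<and> finite (carrier (presented_group X R Mod N)) \<and>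
    gword_class X R w \<notin> N"
proof -
  obtain h where h: "h \<in> hom (presented_group X R) H"
    "\<And>u. u \<in> gwords X \<Longrightarrow> h (gword_class X R u) = wordval H f u"
    using group.presented_hom[OF H(1) f R] by metis
  interpret h: group_hom "presented_group X R" H h
    using H h by (simp add: group_hom_def group_hom_axioms_def group_presented_group)
  let ?N = "kernel (presented_group X R) H h"
  have "(\<lambda>X. the_elem (h ` X)) ` carrier (presented_group X R Mod ?N) \<subseteq> carrier H"
    using h.FactGroup_the_elem_mem by blast
  then have "finite (carrier (presented_group X R Mod ?N))"
    using h.FactGroup_inj_on H(2) inj_on_finite by blast
  moreover have "gword_class X R w \<notin> ?N" using h(2) w by (auto simp: kernel_def)
  ultimately show ?thesis using h.normal_kernel by blast
qed

section \<open>Unitriangular matrices modulo p\<close>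

text \<open>Lower unitriangular matrices of size \<open>n\<close> with entries in \<open>{0..<p}\<close>, extended to infinite
  matrices by the identity.\<close>

definition unitri_group :: "nat \<Rightarrow> nat \<Rightarrow> (nat \<Rightarrow> nat \<Rightarrow> int) monoid" where
  "unitri_group p n =
    \<lparr> carrier = {A. (\<forall>i j. A i j \<in> {0..<int p}) \<and> (\<forall>i. A i i = 1) \<and>
        (\<forall>i j. i < j \<or> n \<le> i \<and> i \<noteq> j \<longrightarrow> A i j = 0)},
      monoid.mult = (\<lambda>A B i j. (\<Sum>k\<le>i. A i k * B k j) mod int p),
      one = (\<lambda>i j. if i = j then 1 else 0) \<rparr>"

text \<open>Built for induction over subdiagonals: with \<open>d = 1\<close> it holds for any two
  unitriangular matrices, and with \<open>d = n\<close> it forces equality in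
  \<open>unitri_group p n\<close>.\<close>

definition agree_below :: "nat \<Rightarrow> (nat \<Rightarrow> nat \<Rightarrow> int) \<Rightarrow> (nat \<Rightarrow> nat \<Rightarrow> int) \<Rightarrow> bool" where
  "agree_below d A B \<longleftrightarrow> (\<forall>i j. i < j + d \<longrightarrow> A i j = B i j)"

locale unitri =
  fixes p n :: nat
  assumes p: "1 < p"
begin

abbreviation "U \<equiv> unitri_group p n"

lemma carrierD:
  assumes "A \<in> carrier U"
  shows "A i j \<in> {0..<int p}" "A i i = 1" "i < j \<Longrightarrow> A i j = 0" "n \<le> i \<Longrightarrow> i \<noteq> j \<Longrightarrow> A i j = 0"
  using assms by (auto simp: unitri_group_def)

lemma entry_mod: "A \<in> carrier U \<Longrightarrow> A i j mod int p = A i j"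
  using carrierD(1) by (meson atLeastLessThan_iff mod_pos_pos_trivial)

lemma mult_entry: "(A \<otimes>\<^bsub>U\<^esub> B) i j = (\<Sum>k\<le>i. A i k * B k j) mod int p"
  by (simp add: unitri_group_def)

text \<open>Splits off the term \<open>k = i\<close>, whose coefficient is the diagonal entry 1;
  this is the form used for forward substitution.\<close>

lemma mult_entry_last:
  "A \<in> carrier U \<Longrightarrow> (A \<otimes>\<^bsub>U\<^esub> B) i j = (B i j + (\<Sum>k<i. A i k * B k j)) mod int p"
  by (simp add: mult_entry carrierD(2) add.commute flip: lessThan_Suc_atMost)

lemma one_entry: "\<one>\<^bsub>U\<^esub> i j = (if i = j then 1 else 0)"
  by (simp add: unitri_group_def)

lemma one_closed: "\<one>\<^bsub>U\<^esub> \<in> carrier U"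
  using p by (auto simp: unitri_group_def)

lemma mult_closed:
  assumes "A \<in> carrier U" "B \<in> carrier U"
  shows "A \<otimes>\<^bsub>U\<^esub> B \<in> carrier U"
proof -
  note A = carrierD[OF assms(1)] and B = carrierD[OF assms(2)]
  have "(A \<otimes>\<^bsub>U\<^esub> B) i i = 1" for i
    using A B p by (simp add: mult_entry_last[OF assms(1)])
  moreover have "(A \<otimes>\<^bsub>U\<^esub> B) i j = 0" if "i < j" for i j
    using A B that by (simp add: mult_entry)
  moreover have "(A \<otimes>\<^bsub>U\<^esub> B) i j = 0" if "n \<le> i" "i \<noteq> j" for i j
    using A B that by (simp add: mult_entry_last[OF assms(1)])
  moreover have "(A \<otimes>\<^bsub>U\<^esub> B) i j \<in> {0..<int p}" for i j
    using p by (simp add: mult_entry)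
  ultimately show ?thesis unfolding unitri_group_def by auto
qed

lemma mult_assoc:
  assumes "A \<in> carrier U" "B \<in> carrier U" "C \<in> carrier U"
  shows "A \<otimes>\<^bsub>U\<^esub> B \<otimes>\<^bsub>U\<^esub> C = A \<otimes>\<^bsub>U\<^esub> (B \<otimes>\<^bsub>U\<^esub> C)"
proof (intro ext)
  fix i j
  have "(A \<otimes>\<^bsub>U\<^esub> B \<otimes>\<^bsub>U\<^esub> C) i j = (\<Sum>k\<le>i. (\<Sum>l\<le>i. A i l * B l k) mod int p * C k j) mod int p"
    by (simp add: mult_entry)
  also have "\<dots> = (\<Sum>k\<le>i. (\<Sum>l\<le>i. A i l * B l k) * C k j) mod int p"
    unfolding cong_def[symmetric] by (intro cong_sum cong_mult) auto
  also have "(\<Sum>k\<le>i. (\<Sum>l\<le>i. A i l * B l k) * C k j) = (\<Sum>l\<le>i. \<Sum>k\<le>i. A i l * (B l k * C k j))"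
    by (subst sum.swap) (simp add: sum_distrib_right mult.assoc)
  \<comment> \<open>The inner range shrinks from \<open>k \<le> i\<close> to
    \<open>k \<le> l\<close> because \<open>B l k\<close> vanishes for \<open>k > l\<close>.\<close>
  also have "\<dots> = (\<Sum>l\<le>i. A i l * (\<Sum>k\<le>l. B l k * C k j))"
    unfolding sum_distrib_left
    by (intro sum.cong refl sum.mono_neutral_right) (auto simp: carrierD(3)[OF assms(2)])
  also have "\<dots> mod int p = (\<Sum>l\<le>i. A i l * ((\<Sum>k\<le>l. B l k * C k j) mod int p)) mod int p"
    unfolding cong_def[symmetric] by (intro cong_sum cong_mult) auto
  also have "\<dots> = (A \<otimes>\<^bsub>U\<^esub> (B \<otimes>\<^bsub>U\<^esub> C)) i j"
    by (simp add: mult_entry)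
  finally show "(A \<otimes>\<^bsub>U\<^esub> B \<otimes>\<^bsub>U\<^esub> C) i j = (A \<otimes>\<^bsub>U\<^esub> (B \<otimes>\<^bsub>U\<^esub> C)) i j" .
qed

lemma mult_one: "A \<in> carrier U \<Longrightarrow> \<one>\<^bsub>U\<^esub> \<otimes>\<^bsub>U\<^esub> A = A" "A \<in> carrier U \<Longrightarrow> A \<otimes>\<^bsub>U\<^esub> \<one>\<^bsub>U\<^esub> = A"
  by (intro ext; simp add: mult_entry one_entry if_distrib if_distribR carrierD(3) entry_mod cong: if_cong)+

text \<open>Outside the top left \<open>n\<close> by \<open>n\<close> block all entries are forced,
  so restriction to that block is injective with values in a finite set.\<close>

lemma finite_carrier: "finite (carrier U)"
proof -
  let ?I = "{..<n} \<times> {..<n}"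
  let ?r = "\<lambda>A. restrict (case_prod A) ?I"
  have "inj_on ?r (carrier U)"
  proof (rule inj_onI, intro ext)
    fix A B i j assume AB: "A \<in> carrier U" "B \<in> carrier U" "?r A = ?r B"
    consider "i < n \<and> j < n" | "i = j" | "i < j" | "n \<le> i \<and> i \<noteq> j" by linarith
    then show "A i j = B i j"
    proof cases
      case 1
      then show ?thesis using fun_cong[OF AB(3), of "(i, j)"] by simp
    qed (use carrierD[OF AB(1)] carrierD[OF AB(2)] in auto)
  qed
  moreover have "?r ` carrier U \<subseteq> ?I \<rightarrow>\<^sub>E {0..<int p}"
    by (rule image_subsetI) (simp only: restrict_PiE_iff, clarsimp simp: carrierD(1)[simplified])
  moreover have "finite (?I \<rightarrow>\<^sub>E {0..<int p})" by (intro finite_PiE) auto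
  ultimately show ?thesis using finite_subset finite_image_iff by metis
qed

text \<open>Forward substitution: as the diagonal of \<open>A\<close> is 1, the product determines
  \<open>B i j\<close> from the rows above \<open>i\<close>. The terms with \<open>k < j\<close>
  vanish, and those with \<open>j \<le> k < i\<close> use only entries \<open>A i k\<close> with
  \<open>i < k + d\<close>.\<close>

lemma cancel_agree_below:
  assumes "A \<in> carrier U" "A' \<in> carrier U" "B \<in> carrier U" "B' \<in> carrier U"
    and "agree_below d A A'" "A \<otimes>\<^bsub>U\<^esub> B = A' \<otimes>\<^bsub>U\<^esub> B'"
  shows "agree_below d B B'"
proof -
  have "\<forall>j. i < j + d \<longrightarrow> B i j = B' i j" for i
  proof (induction i rule: less_induct)
    case (less i)
    show ?case
    proof (intro allI impI)
      fix j assume ij: "i < j + d"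
      have "A i k * B k j = A' i k * B' k j" if "k < i" for k
      proof (cases "k < j")
        case True
        then show ?thesis using carrierD(3)[OF assms(3)] carrierD(3)[OF assms(4)] by simp
      next
        case False
        then have "B k j = B' k j" using less ij that by simp
        moreover have "A i k = A' i k" using False ij assms(5) by (simp add: agree_below_def)
        ultimately show ?thesis by simp
      qed
      then have "(\<Sum>k<i. A i k * B k j) = (\<Sum>k<i. A' i k * B' k j)" by (intro sum.cong) auto
      moreover have "(A \<otimes>\<^bsub>U\<^esub> B) i j = (A' \<otimes>\<^bsub>U\<^esub> B') i j" using assms(6) by simp
      ultimately have "[B i j = B' i j] (mod int p)"
        unfolding mult_entry_last[OF assms(1)] mult_entry_last[OF assms(2)] cong_def[symmetric]
        by (simp add: cong_add_rcancel)
      then show "B i j = B' i j"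
        using entry_mod[OF assms(3)] entry_mod[OF assms(4)] by (simp add: cong_def)
    qed
  qed
  then show ?thesis by (simp add: agree_below_def)
qed

lemma agree_below_eqI:
  assumes "A \<in> carrier U" "B \<in> carrier U" "agree_below n A B"
  shows "A = B"
proof (intro ext)
  fix i j
  show "A i j = B i j"
    using assms(3) carrierD(2-4)[OF assms(1)] carrierD(2-4)[OF assms(2)]
    by (cases "i < n"; cases "i = j") (auto simp: agree_below_def)
qed

lemma group_U: "group U"
proof -
  have ex: "\<exists>B\<in>carrier U. A \<otimes>\<^bsub>U\<^esub> B = \<one>\<^bsub>U\<^esub>" if A: "A \<in> carrier U" for A
  proof -
    \<comment> \<open>Left multiplication is injective on a finite set, hence surjective, which
      yields a right inverse.\<close>
    have "inj_on ((\<otimes>\<^bsub>U\<^esub>) A) (carrier U)"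
      using cancel_agree_below[OF A A _ _ _] agree_below_eqI
      by (intro inj_onI) (auto simp: agree_below_def)
    moreover have "(\<otimes>\<^bsub>U\<^esub>) A ` carrier U \<subseteq> carrier U" using A mult_closed by auto
    ultimately have "(\<otimes>\<^bsub>U\<^esub>) A ` carrier U = carrier U"
      using endo_inj_surj finite_carrier by blast
    then show ?thesis using one_closed by (metis imageE)
  qed
  show ?thesis
  proof (rule groupI)
    show "\<exists>B\<in>carrier U. B \<otimes>\<^bsub>U\<^esub> A = \<one>\<^bsub>U\<^esub>" if A: "A \<in> carrier U" for A
    proof -
      obtain B where B: "B \<in> carrier U" "A \<otimes>\<^bsub>U\<^esub> B = \<one>\<^bsub>U\<^esub>" using ex[OF A] by blast
      obtain C where C: "C \<in> carrier U" "B \<otimes>\<^bsub>U\<^esub> C = \<one>\<^bsub>U\<^esub>" using ex[OF B(1)] by blast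
      \<comment> \<open>The computation C = (A B) C = A (B C) = A turns the right inverse into a
        left inverse.\<close>
      have "C = A" using A B C mult_assoc mult_one by metis
      then show ?thesis using B(1) C(2) by blast
    qed
  qed (auto simp: one_closed mult_closed mult_assoc mult_one)
qed

sublocale U: group U by (rule group_U)

text \<open>The first subdiagonal in which two homomorphisms differ is additive on words, so it is seen by
  the abelianisation.\<close>

lemma mult_agree_below:
  assumes "A \<in> carrier U" "A' \<in> carrier U" "B \<in> carrier U" "B' \<in> carrier U"
    and AA: "agree_below d A A'" and BB: "agree_below d B B'" and d: "0 < d"
  shows "agree_below d (A \<otimes>\<^bsub>U\<^esub> B) (A' \<otimes>\<^bsub>U\<^esub> B')"
    and "[(A' \<otimes>\<^bsub>U\<^esub> B') (j + d) j - (A \<otimes>\<^bsub>U\<^esub> B) (j + d) j =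
      (A' (j + d) j - A (j + d) j) + (B' (j + d) j - B (j + d) j)] (mod int p)"
proof -
  \<comment> \<open>For \<open>k < j\<close> both sides vanish. For
    \<open>j < k < i \<le> j + d\<close> both \<open>i - k\<close> and \<open>k - j\<close> are less
    than \<open>d\<close>, so the factors coincide.\<close>
  have eq: "A i k * B k j = A' i k * B' k j" if "i \<le> j + d" "k \<noteq> j" "k < i" for i j k
  proof (cases "k < j")
    case True
    then show ?thesis using carrierD(3)[OF assms(3)] carrierD(3)[OF assms(4)] by simp
  next
    case False
    then show ?thesis using that AA BB by (auto simp: agree_below_def)
  qed
  have "A i k * B k j = A' i k * B' k j" if ij: "i < j + d" "k \<le> i" for i j k
  proof -
    have "A i j = A' i j" "B i j = B' i j" using ij AA BB by (auto simp: agree_below_def)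
    then show ?thesis
      using eq[of i j k] ij carrierD(2)[OF assms(1)] carrierD(2)[OF assms(2)]
        carrierD(2)[OF assms(3)] carrierD(2)[OF assms(4)]
      by (cases "k = j"; cases "k = i") auto
  qed
  then show "agree_below d (A \<otimes>\<^bsub>U\<^esub> B) (A' \<otimes>\<^bsub>U\<^esub> B')"
    unfolding agree_below_def mult_entry by (auto intro!: arg_cong2[where f = "(mod)"] sum.cong)
  let ?i = "j + d"
  have "(\<Sum>k\<le>?i. A' ?i k * B' k j) - (\<Sum>k\<le>?i. A ?i k * B k j) =
      (\<Sum>k\<le>?i. A' ?i k * B' k j - A ?i k * B k j)"
    by (simp add: sum_subtractf)
  \<comment> \<open>Only \<open>k = j\<close> and \<open>k = j + d\<close> survive, and there one
    factor of each product is a diagonal entry 1. Positivity of \<open>d\<close> keeps the two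
    indices distinct.\<close>
  also have "\<dots> = (\<Sum>k\<in>{j, ?i}. A' ?i k * B' k j - A ?i k * B k j)"
    using eq[of ?i j] by (intro sum.mono_neutral_right) auto
  also have "\<dots> = (A' ?i j - A ?i j) + (B' ?i j - B ?i j)"
    using d carrierD(2)[OF assms(1)] carrierD(2)[OF assms(2)]
      carrierD(2)[OF assms(3)] carrierD(2)[OF assms(4)] by simp
  finally have sum_eq: "(\<Sum>k\<le>?i. A' ?i k * B' k j) - (\<Sum>k\<le>?i. A ?i k * B k j) =
      (A' ?i j - A ?i j) + (B' ?i j - B ?i j)" .
  show "[(A' \<otimes>\<^bsub>U\<^esub> B') ?i j - (A \<otimes>\<^bsub>U\<^esub> B) ?i j =
      (A' ?i j - A ?i j) + (B' ?i j - B ?i j)] (mod int p)"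
    by (simp only: mult_entry cong_def mod_diff_eq sum_eq)
qed

text \<open>The products of \<open>A\<close> and of \<open>A'\<close> with their inverses are both
  the identity. Cancellation then gives the agreement, and additivity of the differences gives the
  sign.\<close>

lemma inv_agree_below:
  assumes "A \<in> carrier U" "A' \<in> carrier U" and AA: "agree_below d A A'" and d: "0 < d"
  shows "agree_below d (inv\<^bsub>U\<^esub> A) (inv\<^bsub>U\<^esub> A')"
    and "[(inv\<^bsub>U\<^esub> A') (j + d) j - (inv\<^bsub>U\<^esub> A) (j + d) j = - (A' (j + d) j - A (j + d) j)] (mod int p)"
proof -
  show *: "agree_below d (inv\<^bsub>U\<^esub> A) (inv\<^bsub>U\<^esub> A')"
    using assms by (intro cancel_agree_below[OF assms(1,2) _ _ AA]) auto
  have "[0 = (A' (j + d) j - A (j + d) j) + ((inv\<^bsub>U\<^esub> A') (j + d) j - (inv\<^bsub>U\<^esub> A) (j + d) j)] (mod int p)"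
    using mult_agree_below(2)[OF assms(1,2) _ _ AA * d, of j] assms by simp
  then show "[(inv\<^bsub>U\<^esub> A') (j + d) j - (inv\<^bsub>U\<^esub> A) (j + d) j = - (A' (j + d) j - A (j + d) j)] (mod int p)"
    by (simp add: cong_iff_dvd_diff algebra_simps dvd_diff_commute)
qed

text \<open>Induction over the letters from the rules for products and inverses. Only a congruence
  can hold, since matrix entries are reduced modulo \<open>p\<close> while the other side is
  evaluated in the integers.\<close>

lemma wordval_agree_below:
  assumes f: "f \<in> X \<rightarrow> carrier U" "f' \<in> X \<rightarrow> carrier U" and d: "0 < d"
    and ff: "\<And>x. x \<in> X \<Longrightarrow> agree_below d (f x) (f' x)"
    and w: "w \<in> gwords X"
  shows "agree_below d (wordval U f w) (wordval U f' w) \<and>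
    [wordval U f' w (j + d) j - wordval U f w (j + d) j =
      wordval integer_group (\<lambda>x. f' x (j + d) j - f x (j + d) j) w] (mod int p)"
  using w
proof (induction w)
  case Nil
  then show ?case by (simp add: agree_below_def)
next
  case (Cons a w)
  let ?\<delta> = "\<lambda>x. f' x (j + d) j - f x (j + d) j"
  define s s' where "s = (if snd a then f (fst a) else inv\<^bsub>U\<^esub> f (fst a))"
    and "s' = (if snd a then f' (fst a) else inv\<^bsub>U\<^esub> f' (fst a))"
  have a: "fst a \<in> X" and w: "w \<in> gwords X" using Cons.prems by auto
  then have fa: "f (fst a) \<in> carrier U" "f' (fst a) \<in> carrier U" using f by auto
  have s: "s \<in> carrier U" "s' \<in> carrier U" "agree_below d s s'"
    "[s' (j + d) j - s (j + d) j = (if snd a then ?\<delta> (fst a) else - ?\<delta> (fst a))] (mod int p)"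
    using fa ff[OF a] inv_agree_below(1)[OF fa ff[OF a] d] inv_agree_below(2)[OF fa ff[OF a] d, of j]
    by (auto simp: s_def s'_def)
  note m = mult_agree_below[OF s(1,2) U.wordval_closed[OF f(1) w] U.wordval_closed[OF f(2) w] s(3)
      conjunct1[OF Cons.IH[OF w]] d]
  have "[(s' \<otimes>\<^bsub>U\<^esub> wordval U f' w) (j + d) j - (s \<otimes>\<^bsub>U\<^esub> wordval U f w) (j + d) j =
      (if snd a then ?\<delta> (fst a) else - ?\<delta> (fst a)) + wordval integer_group ?\<delta> w] (mod int p)"
    by (rule cong_trans[OF m(2)]) (intro cong_add s(4) conjunct2[OF Cons.IH[OF w]])
  then show ?case using m(1) by (cases "snd a") (simp_all add: s_def s'_def)
qed

end

section \<open>Homomorphisms to the integers\<close>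

text \<open>An additive map commutes with natural and then with integer multiples; the coordinates
  of \<open>v\<close> are then switched on one at a time.\<close>

lemma additive_int_vec_expand:
  fixes L :: "int vec \<Rightarrow> int"
  assumes add: "\<And>u v. u \<in> carrier_vec r \<Longrightarrow> v \<in> carrier_vec r \<Longrightarrow> L (u + v) = L u + L v"
    and v: "v \<in> carrier_vec r"
  shows "L v = (\<Sum>j<r. v $ j * L (unit_vec r j))"
proof -
  have zero: "L (0\<^sub>v r) = 0" using add[of "0\<^sub>v r" "0\<^sub>v r"] by simp
  have smult_nat: "L (int k \<cdot>\<^sub>v e) = int k * L e" if e: "e \<in> carrier_vec r" for k e
  proof (induction k)
    case 0
    have "0 \<cdot>\<^sub>v e = 0\<^sub>v r" using e by (intro eq_vecI) auto
    then show ?case using zero by simp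
  next
    case (Suc k)
    have "int (Suc k) \<cdot>\<^sub>v e = int k \<cdot>\<^sub>v e + e" using e by (intro eq_vecI) (auto simp: algebra_simps)
    then show ?case using Suc add[of "int k \<cdot>\<^sub>v e" e] e by (simp add: algebra_simps)
  qed
  have smult: "L (c \<cdot>\<^sub>v e) = c * L e" if e: "e \<in> carrier_vec r" for c e
  proof (cases "0 \<le> c")
    case True
    then show ?thesis using smult_nat[OF e, of "nat c"] by simp
  next
    case False
    have "c \<cdot>\<^sub>v e + int (nat (- c)) \<cdot>\<^sub>v e = 0\<^sub>v r" using e False by (intro eq_vecI) (auto simp: algebra_simps)
    then show ?thesis
      using add[of "c \<cdot>\<^sub>v e" "int (nat (- c)) \<cdot>\<^sub>v e"] smult_nat[OF e, of "nat (- c)"] e False zero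
      by (simp add: algebra_simps)
  qed
  define w where "w k = vec r (\<lambda>i. if i < k then v $ i else 0)" for k
  have "L (w k) = (\<Sum>j<k. v $ j * L (unit_vec r j))" if "k \<le> r" for k
    using that
  proof (induction k)
    case 0
    have "w 0 = 0\<^sub>v r" by (intro eq_vecI) (auto simp: w_def)
    then show ?case using zero by simp
  next
    case (Suc k)
    have "w (Suc k) = w k + v $ k \<cdot>\<^sub>v unit_vec r k"
      using Suc.prems by (intro eq_vecI) (auto simp: w_def less_Suc_eq)
    then show ?case
      using Suc add[of "w k" "v $ k \<cdot>\<^sub>v unit_vec r k"] smult[of "unit_vec r k" "v $ k"] by (simp add: w_def)
  qed
  moreover have "w r = v" using v by (intro eq_vecI) (auto simp: w_def)
  ultimately show ?thesis by fastforce
qed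

lemma hom_integer_group_derived:
  assumes "group G" "h \<in> hom G integer_group" "g \<in> derived G (carrier G)"
  shows "h g = 0"
proof -
  interpret h: group_hom G integer_group h
    using assms by (simp add: group_hom_def group_hom_axioms_def)
  have "derived G (carrier G) \<subseteq> kernel G integer_group h"
    unfolding derived_def
  proof (rule h.G.generate_subgroup_incl[OF _ h.subgroup_kernel], rule subsetI)
    fix g assume "g \<in> derived_set G (carrier G)"
    then obtain a b where "a \<in> carrier G" "b \<in> carrier G"
      "g = a \<otimes>\<^bsub>G\<^esub> b \<otimes>\<^bsub>G\<^esub> inv\<^bsub>G\<^esub> a \<otimes>\<^bsub>G\<^esub> inv\<^bsub>G\<^esub> b" by auto
    then show "g \<in> kernel G integer_group h" by (simp add: kernel_def)
  qed
  then show ?thesis using assms(3) by (auto simp: kernel_def)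
qed

text \<open>On the abelianisation \<open>h\<close> is a row vector c, and \<open>h\<close> after
  \<open>\<theta>\<close> is c E. If \<open>m\<close> divides c E, it divides c E adj(E) = det(E) c,
  and hence c, being coprime to the determinant.\<close>

lemma dvd_hom_of_dvd_hom_endo:
  fixes m :: int
  assumes G: "group G" and \<theta>: "\<theta> \<in> hom G G"
    and \<phi>: "\<phi> \<in> iso (abelianisation G) (monoid_vec TYPE(int) r)"
    and m: "coprime m (det (endo_matrix r (induced_on_Zr G \<phi> \<theta>)))"
    and h: "h \<in> hom G integer_group"
    and dvd: "\<And>g. g \<in> carrier G \<Longrightarrow> m dvd h (\<theta> g)"
    and g: "g \<in> carrier G"
  shows "m dvd h g"
proof -
  interpret G: group G by (rule G)
  interpret h: group_hom G integer_group h
    using G h by (simp add: group_hom_def group_hom_axioms_def)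
  let ?D = "derived G (carrier G)" and ?Z = "monoid_vec TYPE(int) r"
  define q where "q x = ?D #>\<^bsub>G\<^esub> x" for x
  define \<psi> where "\<psi> x = \<phi> (q x)" for x
  have nD: "?D \<lhd> G" by (rule G.derived_self_is_normal)
  have "q \<in> hom G (abelianisation G)"
    unfolding q_def[abs_def] abelianisation_def by (rule normal.r_coset_hom_Mod[OF nD])
  moreover have "\<phi> \<in> hom (abelianisation G) ?Z" using \<phi> by (simp add: iso_def)
  ultimately have \<psi>: "\<psi> \<in> hom G ?Z"
    unfolding \<psi>_def[abs_def] hom_def by (auto simp: Pi_iff)
  have bij: "bij_betw \<phi> (carrier (abelianisation G)) (carrier_vec r)"
    using \<phi> by (simp add: iso_def monoid_vec_simps)
  have carA: "carrier (abelianisation G) = q ` carrier G"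
    by (auto simp: abelianisation_def carrier_FactGroup q_def)
  \<comment> \<open>Elements with the same image under \<open>\<psi>\<close> differ by an element of
    the derived subgroup, which every homomorphism to the integers kills.\<close>
  have eq: "h x = h y" if xy: "x \<in> carrier G" "y \<in> carrier G" "\<psi> x = \<psi> y" for x y
  proof -
    have "q x = q y"
      using bij xy unfolding bij_betw_def inj_on_def carA \<psi>_def by blast
    moreover have "x \<in> q x"
      unfolding q_def using G.rcos_self[OF xy(1) normal_imp_subgroup[OF nD]] .
    ultimately obtain d where "d \<in> ?D" "x = d \<otimes>\<^bsub>G\<^esub> y" unfolding q_def r_coset_def by blast
    moreover from this have "d \<in> carrier G" using subgroup.mem_carrier[OF normal_imp_subgroup[OF nD]] by blast
    ultimately show ?thesis using hom_integer_group_derived[OF G h, of d] xy(2) by simp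
  qed
  \<comment> \<open>A set-theoretic section of \<open>\<psi>\<close>; following it by
    \<open>h\<close> gives the factored map \<open>L\<close>.\<close>
  define s where "s v = (SOME x. x \<in> carrier G \<and> \<psi> x = v)" for v
  have s: "s v \<in> carrier G \<and> \<psi> (s v) = v" if "v \<in> carrier_vec r" for v
  proof -
    have "v \<in> \<phi> ` q ` carrier G" using that bij unfolding carA bij_betw_def by blast
    then have "\<exists>x. x \<in> carrier G \<and> \<psi> x = v" by (auto simp: \<psi>_def)
    then show ?thesis unfolding s_def by (rule someI_ex)
  qed
  have \<psi>_car: "\<psi> x \<in> carrier_vec r" if "x \<in> carrier G" for x
    using \<psi> that by (auto simp: hom_def monoid_vec_simps)
  define L where "L v = h (s v)" for v
  have L: "L (\<psi> x) = h x" if "x \<in> carrier G" for x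
    unfolding L_def using eq[OF _ that] s[OF \<psi>_car[OF that]] by blast
  have L_add: "L (u + v) = L u + L v" if "u \<in> carrier_vec r" "v \<in> carrier_vec r" for u v
  proof -
    have "\<psi> (s u \<otimes>\<^bsub>G\<^esub> s v) = u + v"
      using s[OF that(1)] s[OF that(2)] \<psi> by (simp add: hom_def monoid_vec_simps)
    then show ?thesis
      using L[of "s u \<otimes>\<^bsub>G\<^esub> s v"] s[OF that(1)] s[OF that(2)] by (simp add: L_def)
  qed
  have expand: "L v = (\<Sum>j<r. v $ j * L (unit_vec r j))" if "v \<in> carrier_vec r" for v
    using L_add that by (rule additive_int_vec_expand)
  let ?c = "\<lambda>j. L (unit_vec r j)"
  define E where "E = endo_matrix r (induced_on_Zr G \<phi> \<theta>)"
  have E: "E \<in> carrier_mat r r" by (auto simp: E_def endo_matrix_def)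
  \<comment> \<open>Entry \<open>j\<close> of c E is the value of \<open>h\<close> after
    \<open>\<theta>\<close> at a lift of the \<open>j\<close>-th basis vector.\<close>
  have col: "m dvd (\<Sum>i<r. E $$ (i, j) * ?c i)" if j: "j < r" for j
  proof -
    let ?x = "s (unit_vec r j)"
    have x: "?x \<in> carrier G" "\<psi> ?x = unit_vec r j" using s[of "unit_vec r j"] by auto
    have "inv_into (carrier (abelianisation G)) \<phi> (\<phi> (q ?x)) = q ?x"
      using bij x(1) by (intro inv_into_f_f) (auto simp: bij_betw_def carA)
    then have "induced_on_Zr G \<phi> \<theta> (unit_vec r j) = \<psi> (\<theta> ?x)"
      using x induced_endo_coset[OF G \<theta> x(1)] by (simp add: induced_on_Zr_def \<psi>_def q_def)
    then have "E $$ (i, j) = \<psi> (\<theta> ?x) $ i" if "i < r" for i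
      using that j by (simp add: E_def endo_matrix_def mat_of_cols_def)
    moreover have \<theta>x: "\<theta> ?x \<in> carrier G" using hom_in_carrier[OF \<theta> x(1)] .
    ultimately have "(\<Sum>i<r. E $$ (i, j) * ?c i) = (\<Sum>i<r. \<psi> (\<theta> ?x) $ i * ?c i)" by simp
    also have "\<dots> = h (\<theta> ?x)"
      using expand[OF \<psi>_car[OF \<theta>x]] L[OF \<theta>x] by simp
    finally show ?thesis using dvd[OF x(1)] by simp
  qed
  have "m dvd ?c k" if k: "k < r" for k
  proof -
    let ?A = "adj_mat E"
    have A: "?A \<in> carrier_mat r r" "E * ?A = det E \<cdot>\<^sub>m 1\<^sub>m r" using adj_mat[OF E] by auto
    have E_adj: "(\<Sum>j<r. E $$ (i, j) * ?A $$ (j, k)) = (if i = k then det E else 0)" if i: "i < r" for i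
    proof -
      have "(\<Sum>j<r. E $$ (i, j) * ?A $$ (j, k)) = (E * ?A) $$ (i, k)"
        using E A(1) i k by (simp add: scalar_prod_def lessThan_atLeast0)
      then show ?thesis using A i k by simp
    qed
    have "(\<Sum>i<r. ?c i * (\<Sum>j<r. E $$ (i, j) * ?A $$ (j, k))) =
        (\<Sum>i<r. if i = k then det E * ?c k else 0)"
      by (intro sum.cong) (simp_all add: E_adj)
    then have "(\<Sum>i<r. ?c i * (\<Sum>j<r. E $$ (i, j) * ?A $$ (j, k))) = det E * ?c k"
      using k by simp
    moreover have "(\<Sum>i<r. ?c i * (\<Sum>j<r. E $$ (i, j) * ?A $$ (j, k))) =
        (\<Sum>j<r. ?A $$ (j, k) * (\<Sum>i<r. E $$ (i, j) * ?c i))"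
      unfolding sum_distrib_left by (subst sum.swap) (simp add: ac_simps)
    moreover have "m dvd \<dots>" using col by (intro dvd_sum) auto
    ultimately show ?thesis
      using m coprime_dvd_mult_right_iff unfolding E_def by metis
  qed
  then have "m dvd (\<Sum>j<r. \<psi> g $ j * ?c j)" by (intro dvd_sum) auto
  then show ?thesis using expand[OF \<psi>_car[OF g]] L[OF g] by simp
qed

lemma dvd_wordval_integer_group:
  assumes "\<And>x. x \<in> X \<Longrightarrow> (m :: int) dvd f x" "u \<in> gwords X"
  shows "m dvd wordval integer_group f u"
  using assms(2) by (induction u) (auto simp: assms(1))

section \<open>Separating words by unitriangular matrices\<close>

text \<open>Left multiplication of a reduced syllable list by a power of \<open>x\<close>. When the
  leading exponent cancels, the tail needs no further merging, being reduced already.\<close>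

fun syl_cons :: "'a \<times> int \<Rightarrow> ('a \<times> int) list \<Rightarrow> ('a \<times> int) list" where
  "syl_cons (x, e) [] = [(x, e)]"
| "syl_cons (x, e) ((y, n) # ss) =
    (if x = y then if n + e = 0 then ss else (x, n + e) # ss else (x, e) # (y, n) # ss)"

primrec syllables :: "'a gword \<Rightarrow> ('a \<times> int) list" where
  "syllables [] = []"
| "syllables (a # u) = syl_cons (fst a, if snd a then 1 else - 1) (syllables u)"

primrec sylval :: "('h, 'm) monoid_scheme \<Rightarrow> ('a \<Rightarrow> 'h) \<Rightarrow> ('a \<times> int) list \<Rightarrow> 'h" where
  "sylval H f [] = \<one>\<^bsub>H\<^esub>"
| "sylval H f (s # ss) = f (fst s) [^]\<^bsub>H\<^esub> snd s \<otimes>\<^bsub>H\<^esub> sylval H f ss"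

lemma set_syl_cons:
  assumes "(y, k) \<in> set (syl_cons (x, e) ss)"
  obtains "(y, k) \<in> set ss" | "y = x" "k = e" | n where "y = x" "(x, n) \<in> set ss" "k = n + e" "k \<noteq> 0"
proof (cases ss)
  case Nil
  then show ?thesis using assms that by auto
next
  case (Cons s ts)
  obtain z n where s: "s = (z, n)" by (cases s)
  show ?thesis
  proof (cases "x = z")
    case True
    then show ?thesis
      using assms that by (cases "n + e = 0") (auto simp: Cons s)
  next
    case False
    then show ?thesis using assms that by (auto simp: Cons s)
  qed
qed

lemma syllables_set: "u \<in> gwords X \<Longrightarrow> (x, n) \<in> set (syllables u) \<Longrightarrow> x \<in> X"
proof (induction u arbitrary: x n)
  case (Cons a u)
  from Cons.prems(2)[unfolded syllables.simps] show ?case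
    using Cons.IH Cons.prems(1) by (cases rule: set_syl_cons) auto
qed simp

text \<open>Each letter changes one exponent by 1 or opens a syllable with exponent 1 or -1, and a
  zero exponent is removed. A prime above the word length therefore divides no exponent.\<close>

lemma syllables_exponent:
  "(x, n) \<in> set (syllables u) \<Longrightarrow> n \<noteq> 0 \<and> \<bar>n\<bar> \<le> int (length u)"
proof (induction u arbitrary: x n)
  case (Cons a u)
  from Cons.prems[unfolded syllables.simps] show ?case
  proof (cases rule: set_syl_cons)
    case 1
    then show ?thesis using Cons.IH by force
  next
    case 2
    then show ?thesis by auto
  next
    case (3 k)
    then show ?thesis using Cons.IH[of "fst a" k] by (auto split: if_splits)
  qed
qed simp

text \<open>Consecutive subdiagonal positions will carry the generators of consecutive syllables;
  that these differ is what will make the matrices one-parameter subgroups.\<close>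

lemma distinct_adj_syllables: "distinct_adj (map fst (syllables u))"
proof (induction u)
  case (Cons a u)
  then show ?case
    by (cases "((fst a, if snd a then 1 else - 1 :: int), syllables u)" rule: syl_cons.cases)
      (auto simp: distinct_adj_Cons split: if_splits)
qed simp

lemma (in group) sylval_syl_cons:
  assumes "x \<in> X" "fst ` set ss \<subseteq> X" "f \<in> X \<rightarrow> carrier G"
  shows "sylval G f (syl_cons (x, e) ss) = f x [^] e \<otimes> sylval G f ss"
proof -
  have cl: "sylval G f ts \<in> carrier G" if "fst ` set ts \<subseteq> X" for ts
    using that assms(3) by (induction ts) auto
  show ?thesis
  proof (cases ss)
    case (Cons s ts)
    obtain y n where s: "s = (y, n)" by (cases s)
    have ts: "sylval G f ts \<in> carrier G" using cl assms(2) Cons by auto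
    have fx: "f x \<in> carrier G" using assms by auto
    show ?thesis
    proof (cases "x = y")
      case True
      have "f x [^] e \<otimes> (f x [^] n \<otimes> sylval G f ts) = f x [^] (n + e) \<otimes> sylval G f ts"
        using fx ts by (simp add: int_pow_mult add.commute flip: m_assoc)
      then show ?thesis using True Cons s ts by auto
    qed (simp add: Cons s)
  qed simp
qed

lemma (in group) wordval_eq_sylval:
  assumes "f \<in> X \<rightarrow> carrier G" "u \<in> gwords X"
  shows "wordval G f u = sylval G f (syllables u)"
  using assms(2)
proof (induction u)
  case (Cons a u)
  then have "fst a \<in> X" "fst ` set (syllables u) \<subseteq> X" using syllables_set by fastforce+
  moreover have "f (fst a) \<in> carrier G" using assms(1) Cons.prems by auto
  ultimately show ?case
    using Cons assms(1)
    by (simp add: sylval_syl_cons[where X = X] int_pow_1 int_pow_neg)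
qed simp

text \<open>Evaluation in the presented group itself sends a word to its class, and an evaluation
  depends only on the syllables.\<close>

lemma gword_eq_Nil_if_syllables:
  assumes "u \<in> gwords X" "syllables u = []"
  shows "gword_eq X R u []"
proof -
  interpret P: group "presented_group X R" by (rule group_presented_group)
  have "(\<lambda>x. gword_class X R [(x, True)]) \<in> X \<rightarrow> carrier (presented_group X R)"
    by (auto simp: carrier_presented_group)
  from P.wordval_eq_sylval[OF this assms(1)]
  have "gword_class X R u = gword_class X R []"
    using assms(2) hom_presented_wordval[OF P.group_axioms _ assms(1), of "\<lambda>x. x"]
    by (simp add: hom_def one_presented_group)
  then show ?thesis using assms(1) by (simp add: gword_class_eq_iff)
qed

text \<open>For \<open>idx j \<noteq> idx (j + 1)\<close> the subdiagonal part of each of these matrices squares to zero,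
  so they form one-parameter subgroups. Multiplying the syllables of a word from the right, each
  factor moves the first column down by exactly one row.\<close>

definition subdiag :: "nat \<Rightarrow> nat \<Rightarrow> (nat \<Rightarrow> 'a) \<Rightarrow> 'a \<Rightarrow> int \<Rightarrow> nat \<Rightarrow> nat \<Rightarrow> int" where
  "subdiag p l idx x N i j =
    (if i = j then 1 else if i = Suc j \<and> j < l \<and> idx j = x then N mod int p else 0)"

text \<open>With the syllables read from the right, the lowest nonzero entry of the first column
  descends one row per syllable and is multiplied by the exponent, which is nonzero modulo
  \<open>p\<close>. It ends in row \<open>l > 0\<close>, where the identity has 0.\<close>

lemma separate_word_unitri:
  assumes pr: "prime p" "length u < p" and u: "u \<in> gwords X" "\<not> gword_eq X {} u []"
  obtains n f where "f \<in> X \<rightarrow> carrier (unitri_group p n)"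
    "wordval (unitri_group p n) f u \<noteq> \<one>\<^bsub>unitri_group p n\<^esub>"
proof -
  define ss where "ss = syllables u"
  define l where "l = length ss"
  \<comment> \<open>Syllables are numbered from the right, in the order in which they act on the
    first column.\<close>
  define idx where "idx j = rev (map fst ss) ! j" for j
  define E where "E = subdiag p l idx"
  have l: "0 < l" using gword_eq_Nil_if_syllables[OF u(1)] u(2) by (auto simp: l_def ss_def)
  have idx: "idx j \<noteq> idx (Suc j)" if "Suc j < l" for j
    using distinct_adj_nth[of "rev (map fst ss)" j] distinct_adj_syllables[of u] that
    by (simp add: idx_def ss_def l_def)
  \<comment> \<open>The size \<open>Suc l\<close> makes room for the rows 0 to \<open>l\<close> that
    the first column passes through.\<close>
  interpret unitri p "Suc l" by unfold_locales (use pr prime_gt_1_nat in auto)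
  have E_car: "E x N \<in> carrier U" for x N
    using pr prime_gt_1_nat by (auto simp: E_def subdiag_def unitri_group_def)
  have E_mult: "(E x N \<otimes>\<^bsub>U\<^esub> B) i j =
      (B i j + (if 0 < i \<and> i \<le> l \<and> idx (i - 1) = x then N * B (i - 1) j else 0)) mod int p"
    if "B \<in> carrier U" for x N B i j
  proof (cases i)
    case 0
    then show ?thesis by (simp add: mult_entry_last[OF E_car])
  next
    case (Suc i')
    have "(\<Sum>k<i'. E x N (Suc i') k * B k j) = 0"
      by (intro sum.neutral) (auto simp: E_def subdiag_def)
    then have "(E x N \<otimes>\<^bsub>U\<^esub> B) i j = (B i j + E x N (Suc i') i' * B i' j) mod int p"
      by (simp add: mult_entry_last[OF E_car] Suc)
    moreover have "(b + N mod int p * c) mod int p = (b + N * c) mod int p" for b c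
      by (metis mod_add_right_eq mod_mult_left_eq)
    ultimately show ?thesis by (auto simp: Suc E_def subdiag_def)
  qed
  have E_add: "E x M \<otimes>\<^bsub>U\<^esub> E x N = E x (M + N)" for x M N
  proof (intro ext)
    fix i j
    consider "i = j" | "i = Suc j" | i' where "i = Suc i'" "i' \<noteq> j" "i \<noteq> j" | "i = 0" "i \<noteq> j"
      by (cases i) auto
    then show "(E x M \<otimes>\<^bsub>U\<^esub> E x N) i j = E x (M + N) i j"
    proof cases
      case 1
      then show ?thesis unfolding E_mult[OF E_car] using prime_gt_1_nat[OF pr(1)] by (auto simp: E_def subdiag_def)
    next
      case 2
      have "(N mod int p + M) mod int p = (M + N) mod int p"
        by (subst mod_add_left_eq) (simp add: add.commute)
      then show ?thesis using 2 unfolding E_mult[OF E_car] by (simp add: E_def subdiag_def)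
    next
      case 3
      \<comment> \<open>A nonzero product of two subdiagonal entries would require
        \<open>idx j = x = idx (Suc j)\<close>.\<close>
      then show ?thesis unfolding E_mult[OF E_car] using idx[of j] by (auto simp: E_def subdiag_def)
    next
      case 4
      then show ?thesis unfolding E_mult[OF E_car] by (simp add: E_def subdiag_def)
    qed
  qed
  have "E x \<in> hom integer_group U" for x
    by (rule homI) (auto simp: E_car E_add)
  then have Ehom: "group_hom integer_group U (E x)" for x
    by (simp add: group_hom_def group_hom_axioms_def)
  have E_pow: "E x 1 [^]\<^bsub>U\<^esub> N = E x N" for x and N :: int
    using group_hom.hom_int_pow[OF Ehom, of 1 x N] by simp
  define f where "f x = E x 1" for x
  have f: "f \<in> X \<rightarrow> carrier U" for X by (simp add: f_def E_car)
  \<comment> \<open>Induction over the suffixes of \<open>ss\<close>: the first column of the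
    partial product ends exactly in row \<open>length ts\<close>.\<close>
  have "sylval U f ts \<in> carrier U \<and> (\<forall>i>length ts. sylval U f ts i 0 = 0) \<and>
      sylval U f ts (length ts) 0 \<noteq> 0" if "ss = rs @ ts" for rs ts
    using that
  proof (induction ts arbitrary: rs)
    case Nil
    have "\<one>\<^bsub>U\<^esub> i 0 = 0" if "i > 0" for i using that by (simp add: one_entry)
    moreover have "\<one>\<^bsub>U\<^esub> 0 0 \<noteq> 0" by (simp add: one_entry)
    ultimately show ?case using one_closed by simp
  next
    case (Cons s ts)
    obtain x N where s: "s = (x, N)" by (cases s)
    let ?k = "length ts"
    have IH: "sylval U f ts \<in> carrier U" "\<And>i. i > ?k \<Longrightarrow> sylval U f ts i 0 = 0"
      "sylval U f ts ?k 0 \<noteq> 0"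
      using Cons.IH[of "rs @ [s]"] Cons.prems by auto
    have val: "sylval U f (s # ts) = E x N \<otimes>\<^bsub>U\<^esub> sylval U f ts"
      by (simp add: s f_def E_pow)
    have k: "?k < l" "idx ?k = x"
      using Cons.prems by (auto simp: l_def idx_def s nth_append)
    have "(x, N) \<in> set (syllables u)" using Cons.prems by (simp add: s flip: ss_def)
    then have "N \<noteq> 0" "\<bar>N\<bar> < int p" using syllables_exponent pr(2) by fastforce+
    then have "\<not> int p dvd N" using zdvd_not_zless[of "\<bar>N\<bar>" "int p"] by simp
    moreover have "\<not> int p dvd sylval U f ts ?k 0"
      using IH(3) entry_mod[OF IH(1), of ?k 0] by (simp add: dvd_eq_mod_eq_0)
    moreover have "prime (int p)" using pr(1) by simp
    ultimately have "\<not> int p dvd N * sylval U f ts ?k 0" using prime_dvd_mult_iff by blast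
    moreover have "sylval U f (s # ts) (length (s # ts)) 0 = (N * sylval U f ts ?k 0) mod int p"
      unfolding val E_mult[OF IH(1)] using k IH(2) by simp
    moreover have "sylval U f (s # ts) i 0 = 0" if "i > length (s # ts)" for i
      unfolding val E_mult[OF IH(1)] using that IH(2) by simp
    moreover have "sylval U f (s # ts) \<in> carrier U"
      unfolding val by (rule mult_closed[OF E_car IH(1)])
    ultimately show ?case by (simp only: dvd_eq_mod_eq_0) blast
  qed
  from this[of "[]" ss] have "sylval U f ss l 0 \<noteq> 0" by (simp add: l_def)
  then have "sylval U f ss \<noteq> \<one>\<^bsub>U\<^esub>" using l by (auto simp: one_entry)
  then have "wordval U f u \<noteq> \<one>\<^bsub>U\<^esub>" using U.wordval_eq_sylval[OF f u(1)] by (simp add: ss_def)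
  then show thesis using that f by blast
qed

section \<open>Finite quotients of an ascending HNN extension\<close>

lemma wordval_cong:
  "(\<And>x. x \<in> X \<Longrightarrow> f x = g x) \<Longrightarrow> u \<in> gwords X \<Longrightarrow> wordval H f u = wordval H g u"
  by (induction u) auto

text \<open>Induction on the subdiagonal: the differences of \<open>f\<close> and \<open>f'\<close>
  there define a homomorphism \<open>h\<close> to the integers, and equal pullbacks make
  \<open>h\<close> after \<open>\<theta>\<close> divisible by \<open>p\<close>. As the determinant
  is invertible modulo \<open>p\<close>, \<open>h\<close> itself is divisible by \<open>p\<close>,
  and congruent entries in \<open>{0..<int p}\<close> coincide.\<close>

lemma (in unitri) inj_on_pullback:
  assumes \<theta>: "\<theta> \<in> hom (free_group r) (free_group r)"
    and \<phi>: "\<phi> \<in> iso (abelianisation (free_group r)) (monoid_vec TYPE(int) r)"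
    and det: "coprime (int p) (det (endo_matrix r (induced_on_Zr (free_group r) \<phi> \<theta>)))"
    and T: "\<And>x. x < r \<Longrightarrow> T x \<in> gwords {..<r}"
      "\<And>x. x < r \<Longrightarrow> \<theta> (gword_class {..<r} {} [(x, True)]) = gword_class {..<r} {} (T x)"
  shows "inj_on (\<lambda>f. \<lambda>x\<in>{..<r}. wordval U f (T x)) ({..<r} \<rightarrow>\<^sub>E carrier U)"
proof (rule inj_onI)
  let ?X = "{..<r}"
  fix f f' assume f: "f \<in> ?X \<rightarrow>\<^sub>E carrier U" and f': "f' \<in> ?X \<rightarrow>\<^sub>E carrier U"
    and eq: "(\<lambda>x\<in>?X. wordval U f (T x)) = (\<lambda>x\<in>?X. wordval U f' (T x))"
  have feq: "wordval U f (T x) = wordval U f' (T x)" if "x < r" for x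
    using fun_cong[OF eq, of x] that by simp
  have fU: "f x \<in> carrier U" "f' x \<in> carrier U" if "x < r" for x
    using f f' that by auto
  have agree: "\<forall>x<r. agree_below (Suc d) (f x) (f' x)" for d
  proof (induction d)
    case 0
    then show ?case
      using carrierD(2,3)[OF fU(1)] carrierD(2,3)[OF fU(2)]
      by (auto simp: agree_below_def less_Suc_eq)
  next
    case (Suc d)
    have "f x (j + Suc d) j = f' x (j + Suc d) j" if x: "x < r" for x j
    proof -
      define \<delta> where "\<delta> = (\<lambda>x. f' x (j + Suc d) j - f x (j + Suc d) j)"
      obtain h where h: "h \<in> hom (free_group r) integer_group"
        "\<And>u. u \<in> gwords ?X \<Longrightarrow> h (gword_class ?X {} u) = wordval integer_group \<delta> u"
        using group.presented_hom[OF group_integer_group, of \<delta> ?X "{}"]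
        by (auto simp: free_group_def)
      have "int p dvd h (\<theta> g)" if g: "g \<in> carrier (free_group r)" for g
      proof -
        obtain u where u: "u \<in> gwords ?X" "g = gword_class ?X {} u"
          using g by (auto simp: free_group_def carrier_presented_group)
        have "(\<lambda>g. h (\<theta> g)) \<in> hom (presented_group ?X {}) integer_group"
          using hom_compose[OF \<theta> h(1)] by (simp add: free_group_def comp_def)
        from hom_presented_wordval[OF group_integer_group this u(1)]
        have "h (\<theta> g) = wordval integer_group (\<lambda>x. h (\<theta> (gword_class ?X {} [(x, True)]))) u"
          by (simp add: u(2))
        moreover have "int p dvd h (\<theta> (gword_class ?X {} [(x, True)]))" if "x \<in> ?X" for x
        proof -
          have "x < r" using that by simp
          \<comment> \<open>The left side is 0 because \<open>f\<close> and \<open>f'\<close> have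
            the same value on \<open>T x\<close>.\<close>
          have "[0 = wordval integer_group \<delta> (T x)] (mod int p)"
            using wordval_agree_below[of f ?X f' "Suc d" "T x" j] f f' Suc T(1)[OF \<open>x < r\<close>]
              feq[OF \<open>x < r\<close>]
            by (auto simp: \<delta>_def)
          then show ?thesis
            using T[OF \<open>x < r\<close>] h(2) cong_sym cong_0_iff by metis
        qed
        ultimately show ?thesis using dvd_wordval_integer_group[OF _ u(1)] by simp
      qed
      from dvd_hom_of_dvd_hom_endo[OF _ \<theta> \<phi> det h(1) this, of "gword_class ?X {} [(x, True)]"]
      have "int p dvd \<delta> x"
        using x h(2)[of "[(x, True)]"]
        by (simp add: free_group_def carrier_presented_group group_presented_group)
      then show ?thesis
        using entry_mod[OF fU(1)[OF x], of "j + Suc d" j] entry_mod[OF fU(2)[OF x], of "j + Suc d" j]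
        unfolding \<delta>_def by (metis mod_eq_dvd_iff)
    qed
    moreover have "i < j + Suc (Suc d) \<Longrightarrow> i < j + Suc d \<or> i = j + Suc d" for i j by linarith
    ultimately show ?case using Suc unfolding agree_below_def by metis
  qed
  have "f x = f' x" if "x < r" for x
    using agree[of n] fU that by (intro agree_below_eqI) (auto simp: agree_below_def)
  then show "f = f'" using f f' by (intro PiE_ext) auto
qed

text \<open>The group acts on pairs \<open>(q, f)\<close> of an element of \<open>U\<close> and a homomorphism \<open>f\<close> from the free
  group to \<open>U\<close>: a word \<open>w\<close> of the free group multiplies \<open>q\<close> by \<open>f(w)\<close>, and the stable letter is the
  inverse of precomposing \<open>f\<close> with the endomorphism.\<close>

lemma (in unitri) separate_HNN:
  fixes X :: "'x set" and T :: "'x \<Rightarrow> 'x gword"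
  defines "S \<equiv> X \<rightarrow>\<^sub>E carrier U"
  assumes X: "finite X" and T: "\<And>x. x \<in> X \<Longrightarrow> T x \<in> gwords X"
    and inj: "inj_on (\<lambda>f. \<lambda>x\<in>X. wordval U f (T x)) S"
    and f\<^sub>0: "f\<^sub>0 \<in> X \<rightarrow> carrier U" and u: "u \<in> gwords X" "wordval U f\<^sub>0 u \<noteq> \<one>\<^bsub>U\<^esub>"
  obtains H :: "((nat \<Rightarrow> nat \<Rightarrow> int) \<times> ('x \<Rightarrow> nat \<Rightarrow> nat \<Rightarrow> int) \<Rightarrow>
      (nat \<Rightarrow> nat \<Rightarrow> int) \<times> ('x \<Rightarrow> nat \<Rightarrow> nat \<Rightarrow> int)) monoid" and g
  where "group H" "finite (carrier H)" "g \<in> insert None (Some ` X) \<rightarrow> carrier H"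
    "\<And>x w. x \<in> X \<Longrightarrow> gword_eq X {} (T x) w \<Longrightarrow>
      wordval H g [(None, True), (Some x, True), (None, False)] = wordval H g (lift_gword w)"
    "wordval H g (lift_gword u) \<noteq> \<one>\<^bsub>H\<^esub>"
proof -
  define \<Omega> where "\<Omega> = carrier U \<times> S"
  \<comment> \<open>Multiplication in \<open>BijGroup\<close> is composition with the right factor
    acting first, which matches multiplying the first component on the left by the value of the
    word.\<close>
  define H where "H = BijGroup \<Omega>"
  define \<sigma> where "\<sigma> f = (\<lambda>x\<in>X. wordval U f (T x))" for f
  define act where "act w = (\<lambda>z\<in>\<Omega>. (wordval U (snd z) w \<otimes>\<^bsub>U\<^esub> fst z, snd z))" for w
  define \<tau> where "\<tau> = (\<lambda>z\<in>\<Omega>. (fst z, \<sigma> (snd z)))"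
  define g where "g a = (case a of None \<Rightarrow> inv\<^bsub>H\<^esub> \<tau> | Some x \<Rightarrow> act [(x, True)])" for a
  have g_simps: "g None = inv\<^bsub>H\<^esub> \<tau>" "g (Some x) = act [(x, True)]" for x
    by (simp_all add: g_def)
  have S: "f \<in> X \<rightarrow> carrier U" if "f \<in> S" for f using that by (auto simp: S_def)
  have val: "wordval U f w \<in> carrier U" if "f \<in> S" "w \<in> gwords X" for f w
    using S[OF that(1)] that(2) by (rule U.wordval_closed)
  have finS: "finite S" unfolding S_def using X finite_carrier by (intro finite_PiE) auto
  have fin\<Omega>: "finite \<Omega>" unfolding \<Omega>_def using finS finite_carrier by simp
  interpret H: group H unfolding H_def by (rule group_BijGroup)
  have carH: "carrier H = Bij \<Omega>" and oneH: "\<one>\<^bsub>H\<^esub> = (\<lambda>z\<in>\<Omega>. z)"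
    by (simp_all add: H_def BijGroup_def)
  have multH: "a \<otimes>\<^bsub>H\<^esub> b = compose \<Omega> a b" if "a \<in> Bij \<Omega>" "b \<in> Bij \<Omega>" for a b
    using that by (simp add: H_def BijGroup_def)
  \<comment> \<open>On the finite set \<open>\<Omega>\<close> injectivity suffices; for
    \<open>\<tau>\<close> it comes from \<open>inj\<close>.\<close>
  have BijI: "restrict a \<Omega> \<in> Bij \<Omega>" if "a ` \<Omega> \<subseteq> \<Omega>" "inj_on a \<Omega>" for a
    using that endo_inj_surj[OF fin\<Omega>] by (auto simp: Bij_def bij_betw_def)
  have act_Bij: "act w \<in> Bij \<Omega>" if "w \<in> gwords X" for w
    unfolding act_def
  proof (rule BijI)
    show "(\<lambda>z. (wordval U (snd z) w \<otimes>\<^bsub>U\<^esub> fst z, snd z)) ` \<Omega> \<subseteq> \<Omega>"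
      using that val by (auto simp: \<Omega>_def)
    show "inj_on (\<lambda>z. (wordval U (snd z) w \<otimes>\<^bsub>U\<^esub> fst z, snd z)) \<Omega>"
      using that val by (intro inj_onI) (auto simp: \<Omega>_def)
  qed
  have \<sigma>S: "\<sigma> f \<in> S" if "f \<in> S" for f
    using val[OF that T] by (auto simp: S_def \<sigma>_def)
  have \<tau>_Bij: "\<tau> \<in> Bij \<Omega>"
    unfolding \<tau>_def
  proof (rule BijI)
    show "(\<lambda>z. (fst z, \<sigma> (snd z))) ` \<Omega> \<subseteq> \<Omega>" using \<sigma>S by (auto simp: \<Omega>_def)
    show "inj_on (\<lambda>z. (fst z, \<sigma> (snd z))) \<Omega>"
      using inj by (intro inj_onI) (auto simp: \<Omega>_def \<sigma>_def[abs_def] dest: inj_onD)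
  qed
  have act_append: "act (v @ w) = act v \<otimes>\<^bsub>H\<^esub> act w" if "v \<in> gwords X" "w \<in> gwords X" for v w
  proof -
    have "act (v @ w) = compose \<Omega> (act v) (act w)"
      using that val
      by (intro ext) (auto simp: act_def compose_def \<Omega>_def U.wordval_append[OF S] U.m_assoc)
    then show ?thesis using that act_Bij multH by simp
  qed
  have act_eq: "act v = act w" if "gword_eq X {} v w" for v w
    unfolding act_def using S U.wordval_gword_eq[OF that]
    by (intro restrict_ext) (auto simp: \<Omega>_def)
  have act_Nil: "act [] = \<one>\<^bsub>H\<^esub>"
    unfolding oneH act_def by (rule restrict_ext) (auto simp: \<Omega>_def)
  have lift: "wordval H g (lift_gword w) = act w" if "w \<in> gwords X" for w
    using that
  proof (induction w)
    case Nil
    then show ?case by (simp add: lift_gword_def act_Nil)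
  next
    case (Cons a w)
    obtain x b where a: "a = (x, b)" by (cases a)
    have x: "x \<in> X" "w \<in> gwords X" using Cons.prems by (auto simp: a)
    have "act [(x, False)] \<otimes>\<^bsub>H\<^esub> act [(x, True)] = \<one>\<^bsub>H\<^esub>"
      using x act_append[of "[(x, False)]" "[(x, True)]"] act_eq[OF gword_eq.cancel[of x X "{}" False]]
      by (simp add: act_Nil)
    then have "inv\<^bsub>H\<^esub> act [(x, True)] = act [(x, False)]"
      using x act_Bij by (intro H.inv_equality) (auto simp: carH)
    then have "wordval H g (lift_gword (a # w)) = act [(x, b)] \<otimes>\<^bsub>H\<^esub> act w"
      using Cons.IH[OF x(2)] by (simp add: a lift_gword_def g_simps)
    then show ?case using x act_append[of "[(x, b)]" w] by (simp add: a)
  qed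
  have "wordval H g [(None, True), (Some x, True), (None, False)] = wordval H g (lift_gword w)"
    if x: "x \<in> X" and w: "gword_eq X {} (T x) w" for x w
  proof -
    have wX: "w \<in> gwords X" using gword_eq_gwords[OF w] by simp
    have a: "act [(x, True)] \<in> carrier H" "act w \<in> carrier H" "\<tau> \<in> carrier H"
      using act_Bij x wX \<tau>_Bij by (auto simp: carH)
    \<comment> \<open>As t acts by the inverse of \<open>\<tau>\<close>, the relation t x t^-1 = w
      becomes this commutation rule. It holds because \<open>\<sigma> f\<close> takes at
      \<open>x\<close> the value of \<open>f\<close> on \<open>T x\<close>, which is its value on
      \<open>w\<close>.\<close>
    have "compose \<Omega> (act [(x, True)]) \<tau> = compose \<Omega> \<tau> (act w)"
    proof
      fix z
      show "compose \<Omega> (act [(x, True)]) \<tau> z = compose \<Omega> \<tau> (act w) z"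
      proof (cases "z \<in> \<Omega>")
        case True
        then obtain q f where z: "z = (q, f)" "q \<in> carrier U" "f \<in> S" by (auto simp: \<Omega>_def)
        have "wordval U (\<sigma> f) [(x, True)] = wordval U f w"
          using x val[OF z(3) wX] U.wordval_gword_eq[OF w S[OF z(3)]] by (simp add: \<sigma>_def)
        then show ?thesis
          using z \<sigma>S[OF z(3)] val[OF z(3) wX]
          by (simp add: compose_def act_def \<tau>_def \<Omega>_def)
      qed (simp add: compose_def)
    qed
    then have "act [(x, True)] \<otimes>\<^bsub>H\<^esub> \<tau> = \<tau> \<otimes>\<^bsub>H\<^esub> act w"
      using a by (simp add: carH multH)
    then have "act w = inv\<^bsub>H\<^esub> \<tau> \<otimes>\<^bsub>H\<^esub> (act [(x, True)] \<otimes>\<^bsub>H\<^esub> \<tau>)"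
      using a by (subst H.inv_solve_left) auto
    then show ?thesis using a lift[OF wX] by (simp add: g_simps)
  qed
  moreover have "act u \<noteq> \<one>\<^bsub>H\<^esub>"
  proof
    assume act: "act u = \<one>\<^bsub>H\<^esub>"
    \<comment> \<open>At this point \<open>act u\<close> changes the first component from the
      identity to the value of \<open>u\<close> under \<open>f\<^sub>0\<close>.\<close>
    let ?z = "(\<one>\<^bsub>U\<^esub>, restrict f\<^sub>0 X)"
    have z: "?z \<in> \<Omega>" using f\<^sub>0 one_closed by (auto simp: \<Omega>_def S_def)
    have "wordval U (restrict f\<^sub>0 X) u = wordval U f\<^sub>0 u"
      by (rule wordval_cong[OF _ u(1)]) simp
    then have "wordval U f\<^sub>0 u \<otimes>\<^bsub>U\<^esub> \<one>\<^bsub>U\<^esub> = \<one>\<^bsub>U\<^esub>"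
      using fun_cong[OF act, of ?z] z by (simp add: act_def oneH)
    then show False using u f\<^sub>0 U.wordval_closed[OF f\<^sub>0 u(1)] by simp
  qed
  moreover have "finite (carrier H)"
  proof (rule finite_subset)
    show "carrier H \<subseteq> \<Omega> \<rightarrow>\<^sub>E \<Omega>"
      by (auto simp: carH Bij_def bij_betw_def PiE_def)
    show "finite (\<Omega> \<rightarrow>\<^sub>E \<Omega>)" using fin\<Omega> by (intro finite_PiE) auto
  qed
  moreover have "g \<in> insert None (Some ` X) \<rightarrow> carrier H"
    using \<tau>_Bij act_Bij by (auto simp: g_def simp flip: carH)
  ultimately show thesis using that[of H g] lift[OF u(1)] H.group_axioms by metis
qed

section \<open>Normal forms in an ascending HNN extension\<close>


lemma gword_eq_append_left:
  "gword_eq X R v w \<Longrightarrow> u \<in> gwords X \<Longrightarrow> gword_eq X R (u @ v) (u @ w)"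
  by (simp add: gword_eq.append gword_eq.refl)

lemma gword_eq_append_right:
  "gword_eq X R u v \<Longrightarrow> w \<in> gwords X \<Longrightarrow> gword_eq X R (u @ w) (v @ w)"
  by (simp add: gword_eq.append gword_eq.refl)

lemma lift_gword_simps [simp]:
  "lift_gword [] = []"
  "lift_gword (a # u) = (Some (fst a), snd a) # lift_gword u"
  "lift_gword (u @ v) = lift_gword u @ lift_gword v"
  by (auto simp: lift_gword_def map_prod_def split: prod.splits)

lemma lift_gword_gwords [simp]:
  "u \<in> gwords X \<Longrightarrow> lift_gword u \<in> gwords (insert None (Some ` X))"
  by (induction u) auto

lemma lift_gword_eq:
  "gword_eq X {} u v \<Longrightarrow> gword_eq (insert None (Some ` X)) R (lift_gword u) (lift_gword v)"
proof (induction rule: gword_eq.induct)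
  case (append u v u' v')
  then show ?case by (simp add: gword_eq.append)
next
  case (cancel x b)
  then show ?case using gword_eq.cancel[of "Some x" _ R b] by simp
qed (auto intro: gword_eq.refl gword_eq.sym gword_eq.trans)

context
  fixes X :: "'x set" and R :: "('x option gword \<times> 'x option gword) set" and T :: "'x \<Rightarrow> 'x gword"
    and Y :: "'x option set"
  defines "Y \<equiv> insert None (Some ` X)"
  assumes T: "\<And>x. x \<in> X \<Longrightarrow> T x \<in> gwords X"
    and rel: "\<And>x. x \<in> X \<Longrightarrow>
      gword_eq Y R [(None, True), (Some x, True), (None, False)] (lift_gword (T x))"
begin

lemma lift_in_Y: "u \<in> gwords X \<Longrightarrow> lift_gword u \<in> gwords Y"
  unfolding Y_def by simp

lemma None_in_Y: "None \<in> Y"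
  by (simp add: Y_def)

text \<open>For a positive letter this is the relation multiplied by t on the right. For an inverse
  letter, \<open>v\<close> is a word inverse to \<open>T x\<close> in the free group.\<close>

lemma stable_letter_generator:
  assumes x: "x \<in> X"
  shows "\<exists>v\<in>gwords X. gword_eq Y R [(None, True), (Some x, b)] (lift_gword v @ [(None, True)])"
proof -
  have xY: "Some x \<in> Y" using x by (simp add: Y_def)
  have "gword_eq Y R ([(None, True), (Some x, True)] @ [(None, False), (None, True)])
      ([(None, True), (Some x, True)] @ [])"
    using gword_eq.cancel[OF None_in_Y, of R False] xY None_in_Y
    by (intro gword_eq_append_left) auto
  moreover have "gword_eq Y R ([(None, True), (Some x, True), (None, False)] @ [(None, True)])
      (lift_gword (T x) @ [(None, True)])"
    using rel[OF x] None_in_Y by (intro gword_eq_append_right) auto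
  ultimately have pos: "gword_eq Y R [(None, True), (Some x, True)] (lift_gword (T x) @ [(None, True)])"
    using gword_eq.sym gword_eq.trans by fastforce
  show ?thesis
  proof (cases b)
    case True
    then show ?thesis using pos T[OF x] by auto
  next
    case False
    obtain v where v: "v \<in> gwords X" "gword_eq X {} (v @ T x) []"
      using gword_inverse[OF T[OF x]] by blast
    have "gword_eq Y R (lift_gword v @ lift_gword (T x)) []"
      using lift_gword_eq[OF v(2), of R] by (simp add: Y_def)
    from gword_eq_append_right[OF this, of "[(None, True), (Some x, False)]"]
    have 1: "gword_eq Y R (lift_gword v @ lift_gword (T x) @ [(None, True), (Some x, False)])
        [(None, True), (Some x, False)]"
      using xY None_in_Y by simp
    from gword_eq_append_left[OF gword_eq_append_right[OF pos, of "[(Some x, False)]"] lift_in_Y[OF v(1)]]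
    have 2: "gword_eq Y R (lift_gword v @ [(None, True), (Some x, True), (Some x, False)])
        (lift_gword v @ lift_gword (T x) @ [(None, True), (Some x, False)])"
      using xY by simp
    from gword_eq_append_left[OF gword_eq.cancel[OF xY, of R True], of "lift_gword v @ [(None, True)]"]
    have 3: "gword_eq Y R (lift_gword v @ [(None, True), (Some x, True), (Some x, False)])
        (lift_gword v @ [(None, True)])"
      using None_in_Y lift_in_Y[OF v(1)] by simp
    have "gword_eq Y R [(None, True), (Some x, False)] (lift_gword v @ [(None, True)])"
      using gword_eq.trans[OF gword_eq.sym[OF 1] gword_eq.trans[OF gword_eq.sym[OF 2] 3]] .
    then show ?thesis using False v(1) by auto
  qed
qed

lemma stable_letter_word:
  assumes "u \<in> gwords X"
  shows "\<exists>v\<in>gwords X. gword_eq Y R ([(None, True)] @ lift_gword u) (lift_gword v @ [(None, True)])"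
  using assms
proof (induction u)
  case Nil
  have "gword_eq Y R [(None, True)] [(None, True)]" using None_in_Y by (intro gword_eq.refl) simp
  then show ?case by (intro bexI[of _ "[]"]) auto
next
  case (Cons a u)
  obtain x b where a: "a = (x, b)" by (cases a)
  have x: "x \<in> X" "u \<in> gwords X" using Cons.prems by (auto simp: a)
  obtain v where v: "v \<in> gwords X"
    "gword_eq Y R [(None, True), (Some x, b)] (lift_gword v @ [(None, True)])"
    using stable_letter_generator[OF x(1)] by blast
  obtain w where w: "w \<in> gwords X"
    "gword_eq Y R ([(None, True)] @ lift_gword u) (lift_gword w @ [(None, True)])"
    using Cons.IH[OF x(2)] by blast
  have "gword_eq Y R ([(None, True), (Some x, b)] @ lift_gword u)
      ((lift_gword v @ [(None, True)]) @ lift_gword u)"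
    using v(2) lift_in_Y[OF x(2)] by (rule gword_eq_append_right)
  moreover have "gword_eq Y R (lift_gword v @ ([(None, True)] @ lift_gword u))
      (lift_gword v @ (lift_gword w @ [(None, True)]))"
    using w(2) lift_in_Y[OF v(1)] by (rule gword_eq_append_left)
  ultimately have "gword_eq Y R ([(None, True)] @ lift_gword (a # u)) (lift_gword (v @ w) @ [(None, True)])"
    using gword_eq.trans by (fastforce simp: a)
  then show ?case using v(1) w(1) by (intro bexI[of _ "v @ w"]) auto
qed

abbreviation "pow_t m \<equiv> replicate m (None, True)"

lemma pow_t_gwords: "pow_t m \<in> gwords Y"
  using None_in_Y by (induction m) auto

lemma stable_power_word:
  assumes "u \<in> gwords X"
  shows "\<exists>v\<in>gwords X. gword_eq Y R (pow_t m @ lift_gword u) (lift_gword v @ pow_t m)"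
proof (induction m)
  case 0
  then show ?case using assms by (intro bexI[of _ u]) (auto intro: gword_eq.refl lift_in_Y)
next
  case (Suc m)
  then obtain v where v: "v \<in> gwords X" "gword_eq Y R (pow_t m @ lift_gword u) (lift_gword v @ pow_t m)"
    by blast
  obtain w where w: "w \<in> gwords X"
    "gword_eq Y R ([(None, True)] @ lift_gword v) (lift_gword w @ [(None, True)])"
    using stable_letter_word[OF v(1)] by blast
  have "gword_eq Y R ([(None, True)] @ (pow_t m @ lift_gword u)) ([(None, True)] @ (lift_gword v @ pow_t m))"
    using v(2) None_in_Y by (intro gword_eq_append_left) auto
  moreover have "gword_eq Y R (([(None, True)] @ lift_gword v) @ pow_t m)
      ((lift_gword w @ [(None, True)]) @ pow_t m)"
    using w(2) pow_t_gwords by (rule gword_eq_append_right)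
  ultimately have "gword_eq Y R (pow_t (Suc m) @ lift_gword u) (lift_gword w @ pow_t (Suc m))"
    using gword_eq.trans by fastforce
  then show ?case using w(1) by blast
qed

text \<open>This is w = t^-n u t^m without negative powers. Only t, and in general not its inverse,
  can be moved to the right past words over \<open>X\<close>, so \<open>n\<close> grows exactly when
  an inverse stable letter is appended and no power of t is left to absorb it.\<close>

lemma HNN_normal_form:
  assumes "w \<in> gwords Y"
  shows "\<exists>n m. \<exists>u\<in>gwords X. gword_eq Y R (pow_t n @ w) (lift_gword u @ pow_t m)"
  using assms
proof (induction w rule: rev_induct)
  case Nil
  have "gword_eq Y R (pow_t 0 @ []) (lift_gword [] @ pow_t 0)"
    by (simp add: gword_eq.refl)
  then show ?case using gwords_simps(1) by blast
next
  case (snoc a w)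
  have a: "[a] \<in> gwords Y" and w: "w \<in> gwords Y" using snoc.prems by auto
  obtain n m u where u: "u \<in> gwords X" "gword_eq Y R (pow_t n @ w) (lift_gword u @ pow_t m)"
    using snoc.IH[OF w] by blast
  have step: "gword_eq Y R (pow_t n @ (w @ [a])) (lift_gword u @ pow_t m @ [a])"
    using gword_eq_append_right[OF u(2) a] by simp
  consider x b where "a = (Some x, b)" "x \<in> X" | "a = (None, True)" |
    k where "a = (None, False)" "m = Suc k" | "a = (None, False)" "m = 0"
    using a by (cases a; cases m; cases "snd a") (auto simp: Y_def)
  then show ?case
  proof cases
    case 1
    then obtain v where v: "v \<in> gwords X"
      "gword_eq Y R (pow_t m @ lift_gword [(x, b)]) (lift_gword v @ pow_t m)"
      using stable_power_word[of "[(x, b)]" m] by auto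
    have "gword_eq Y R (lift_gword u @ (pow_t m @ [a])) (lift_gword u @ (lift_gword v @ pow_t m))"
      using gword_eq_append_left[OF v(2) lift_in_Y[OF u(1)]] by (simp add: 1)
    then have "gword_eq Y R (pow_t n @ (w @ [a])) (lift_gword (u @ v) @ pow_t m)"
      using gword_eq.trans[OF step] by simp
    moreover have "u @ v \<in> gwords X" using u v by simp
    ultimately show ?thesis by blast
  next
    case 2
    then have "gword_eq Y R (pow_t n @ (w @ [a])) (lift_gword u @ pow_t (Suc m))"
      using step by (simp add: replicate_append_same)
    then show ?thesis using u(1) by blast
  next
    case 3
    have "gword_eq Y R ((lift_gword u @ pow_t k) @ [(None, True), (None, False)]) ((lift_gword u @ pow_t k) @ [])"
      using gword_eq.cancel[OF None_in_Y, of R True] lift_in_Y[OF u(1)] pow_t_gwords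
      by (intro gword_eq_append_left) auto
    moreover have "pow_t m @ [a] = pow_t k @ [(None, True), (None, False)]"
      by (simp add: 3 replicate_app_Cons_same)
    ultimately have "gword_eq Y R (pow_t n @ (w @ [a])) (lift_gword u @ pow_t k)"
      using gword_eq.trans[OF step] by simp
    then show ?thesis using u(1) by blast
  next
    case 4
    \<comment> \<open>With no t left to cancel, one more t is put in front of both sides and moved
      through \<open>u\<close> until it meets the new letter.\<close>
    obtain v where v: "v \<in> gwords X"
      "gword_eq Y R ([(None, True)] @ lift_gword u) (lift_gword v @ [(None, True)])"
      using stable_letter_word[OF u(1)] by blast
    from gword_eq_append_left[OF step, of "[(None, True)]"]
    have 1: "gword_eq Y R ((None, True) # pow_t n @ w @ [a]) ((None, True) # lift_gword u @ [a])"
      using None_in_Y by (simp add: 4)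
    from gword_eq_append_right[OF v(2) a]
    have 2: "gword_eq Y R ((None, True) # lift_gword u @ [a]) (lift_gword v @ [(None, True), a])"
      by simp
    from gword_eq_append_left[OF gword_eq.cancel[OF None_in_Y, of R True] lift_in_Y[OF v(1)]]
    have 3: "gword_eq Y R (lift_gword v @ [(None, True), a]) (lift_gword v)"
      by (simp add: 4)
    have "gword_eq Y R (pow_t (Suc n) @ (w @ [a])) (lift_gword v @ pow_t 0)"
      using gword_eq.trans[OF gword_eq.trans[OF 1 2] 3] by simp
    then show ?thesis using v(1) by blast
  qed
qed

end

section \<open>Residual finiteness of the ascending HNN extension\<close>

theorem theorem6p2:
  fixes r :: nat
    and \<theta> :: "nat gword set \<Rightarrow> nat gword set"
    and \<phi> :: "nat gword set set \<Rightarrow> int vec"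
  assumes "r \<ge> 2"
    and "\<theta> \<in> hom (free_group r) (free_group r)"
    and "inj_on \<theta> (carrier (free_group r))"
    and "\<phi> \<in> iso (abelianisation (free_group r)) (monoid_vec TYPE(int) r)"
    and "det (endo_matrix r (induced_on_Zr (free_group r) \<phi> \<theta>)) \<noteq> 0"
  shows "residually_finite (ascending_HNN {..<r} {} \<theta>)"
proof -
  let ?X = "{..<r}"
  let ?c = "gword_class ?X {}"
  define Y where "Y = insert None (Some ` ?X)"
  define R where "R = {([(None, True), (Some x, True), (None, False)], lift_gword w) | x w.
    x \<in> ?X \<and> w \<in> \<theta> (?c [(x, True)])}"
  define G where "G = presented_group Y R"
  have G: "ascending_HNN ?X {} \<theta> = G"
    by (simp add: ascending_HNN_def G_def Y_def R_def)
  have "\<exists>u\<in>gwords ?X. \<theta> (?c [(x, True)]) = ?c u" if "x < r" for x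
    using hom_in_carrier[OF assms(2), of "?c [(x, True)]"] that
    by (auto simp: free_group_def carrier_presented_group)
  \<comment> \<open>\<open>T\<close> fixes one word for the image of each generator; the other
    representatives equal it in the free group.\<close>
  then obtain T where T: "\<And>x. x < r \<Longrightarrow> T x \<in> gwords ?X" "\<And>x. x < r \<Longrightarrow> \<theta> (?c [(x, True)]) = ?c (T x)"
    by metis
  have TX: "\<And>x. x \<in> ?X \<Longrightarrow> T x \<in> gwords ?X" using T(1) by simp
  have mem: "w \<in> \<theta> (?c [(x, True)]) \<longleftrightarrow> gword_eq ?X {} (T x) w" if "x < r" for x w
    unfolding T(2)[OF that] by (simp add: gword_class_def)
  have R_iff: "(a, b) \<in> R \<longleftrightarrow> (\<exists>x w. x < r \<and> gword_eq ?X {} (T x) w \<and>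
      a = [(None, True), (Some x, True), (None, False)] \<and> b = lift_gword w)" for a b
    unfolding R_def using mem by auto
  have rel: "gword_eq Y R [(None, True), (Some x, True), (None, False)] (lift_gword (T x))"
    if "x \<in> ?X" for x
  proof (rule gword_eq.relation)
    show "([(None, True), (Some x, True), (None, False)], lift_gword (T x)) \<in> R"
      using that T(1) gword_eq.refl unfolding R_iff by blast
    show "[(None, True), (Some x, True), (None, False)] \<in> gwords Y" using that by (simp add: Y_def)
    show "lift_gword (T x) \<in> gwords Y" using that T(1) by (simp add: Y_def)
  qed
  have "\<exists>N. N \<lhd> G \<and> finite (carrier (G Mod N)) \<and> gword_class Y R w \<notin> N"
    if w: "w \<in> gwords Y" "gword_class Y R w \<noteq> \<one>\<^bsub>G\<^esub>" for w
  proof -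
    let ?t = "\<lambda>m. replicate m (None :: nat option, True)"
    obtain n m u where u: "u \<in> gwords ?X" "gword_eq Y R (?t n @ w) (lift_gword u @ ?t m)"
      using HNN_normal_form[OF TX rel[unfolded Y_def] w(1)[unfolded Y_def]] unfolding Y_def by auto
    have t: "?t k \<in> gwords Y" for k by (induction k) (auto simp: Y_def)
    have lu: "lift_gword u \<in> gwords Y" using u(1) by (simp add: Y_def)
    show ?thesis
    proof (cases "n = m")
      case False
      \<comment> \<open>This modulus exceeds \<open>n\<close> and \<open>m\<close>, so they stay
        distinct modulo \<open>k\<close>, and it is at least 2, so 1 lies in the carrier of the
        cyclic group.\<close>
      define k where "k = n + m + 2"
      \<comment> \<open>The exponent sum of t modulo \<open>k\<close>; both sides of every relation
        have sum 0.\<close>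
      define f :: "nat option \<Rightarrow> int" where "f a = (if a = None then 1 else 0)" for a
      let ?Z = "integer_mod_group k"
      interpret Z: group ?Z by (rule group_integer_mod_group)
      have f: "f \<in> Y \<rightarrow> carrier ?Z" by (auto simp: f_def k_def carrier_integer_mod_group)
      have lift: "wordval ?Z f (lift_gword v) = 0" for v :: "nat gword"
        by (induction v) (auto simp: f_def)
      have pow: "wordval ?Z f (?t l) = int l mod int k" for l
        by (induction l) (auto simp: f_def mod_simps)
      have resp: "wordval ?Z f a = wordval ?Z f b" if "(a, b) \<in> R" for a b
        using that unfolding R_iff
        by (auto simp: lift) (auto simp: f_def k_def mod_simps carrier_integer_mod_group)
      have "wordval ?Z f (?t n @ w) = wordval ?Z f (lift_gword u @ ?t m)"
        using Z.wordval_gword_eq[OF u(2) f] resp by blast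
      then have eq: "(int n mod int k + wordval ?Z f w) mod int k = int m mod int k"
        using t w(1) lu by (simp add: Z.wordval_append[OF f] lift pow mod_simps)
      have "wordval ?Z f w \<noteq> \<one>\<^bsub>?Z\<^esub>"
        using eq False by (auto simp: k_def mod_simps)
      then show ?thesis
        using presented_group_separate[OF Z.group_axioms _ f resp w(1)]
        by (auto simp: G_def carrier_integer_mod_group k_def)
    next
      case True
      \<comment> \<open>If \<open>u\<close> were trivial in the free group, then t^n w = t^n, and
        cancelling would make w trivial.\<close>
      have u_neq: "\<not> gword_eq ?X {} u []"
      proof
        assume "gword_eq ?X {} u []"
        then have "gword_eq Y R (lift_gword u @ ?t n) ([] @ ?t n)"
          using lift_gword_eq[of ?X u "[]" R] t by (intro gword_eq_append_right) (simp_all add: Y_def)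
        then have "gword_eq Y R (?t n @ w) (?t n)"
          using gword_eq.trans u(2) True by fastforce
        then have "gword_class Y R (?t n) \<otimes>\<^bsub>G\<^esub> gword_class Y R w = gword_class Y R (?t n)"
          using t[of n] w(1) by (simp add: G_def mult_presented_group gword_class_eq_iff)
        then show False
          using group.l_cancel_one[OF group_presented_group, of "gword_class Y R (?t n)" Y R "gword_class Y R w"]
            w t[of n] by (simp add: G_def carrier_presented_group)
      qed
      define D where "D = det (endo_matrix r (induced_on_Zr (free_group r) \<phi> \<theta>))"
      \<comment> \<open>The prime exceeds the length of \<open>u\<close>, to separate
        \<open>u\<close> from the identity, and the absolute value of the nonzero determinant, so as
        not to divide it.\<close>
      obtain p where pr: "prime p" "p > length u + nat \<bar>D\<bar>" using bigger_prime by blast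
      have "length u < p" using pr(2) by simp
      from separate_word_unitri[OF pr(1) this u(1) u_neq]
      obtain d f\<^sub>0 where f\<^sub>0: "f\<^sub>0 \<in> ?X \<rightarrow> carrier (unitri_group p d)"
        "wordval (unitri_group p d) f\<^sub>0 u \<noteq> \<one>\<^bsub>unitri_group p d\<^esub>" .
      interpret unitri p d by unfold_locales (rule prime_gt_1_nat[OF pr(1)])
      have "\<not> int p dvd D" using pr(2) assms(5) zdvd_not_zless[of "\<bar>D\<bar>" "int p"] by (simp add: D_def)
      then have "coprime (int p) D" using pr(1) by (intro prime_imp_coprime) auto
      then have "inj_on (\<lambda>f. \<lambda>x\<in>?X. wordval U f (T x)) (?X \<rightarrow>\<^sub>E carrier U)"
        using inj_on_pullback[OF assms(2,4) _ T] by (simp add: D_def)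
      from separate_HNN[OF finite_lessThan TX this f\<^sub>0(1) u(1) f\<^sub>0(2), folded Y_def]
      obtain H :: "((nat \<Rightarrow> nat \<Rightarrow> int) \<times> (nat \<Rightarrow> nat \<Rightarrow> nat \<Rightarrow> int) \<Rightarrow>
          (nat \<Rightarrow> nat \<Rightarrow> int) \<times> (nat \<Rightarrow> nat \<Rightarrow> nat \<Rightarrow> int)) monoid" and g
        where H: "group H" "finite (carrier H)" "g \<in> Y \<rightarrow> carrier H"
          "\<And>x w. x \<in> ?X \<Longrightarrow> gword_eq ?X {} (T x) w \<Longrightarrow>
            wordval H g [(None, True), (Some x, True), (None, False)] = wordval H g (lift_gword w)"
          "wordval H g (lift_gword u) \<noteq> \<one>\<^bsub>H\<^esub>"
        by blast
      interpret H: group H by (rule H(1))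
      have resp: "wordval H g a = wordval H g b" if "(a, b) \<in> R" for a b
        using that H(4) unfolding R_iff by blast
      have "wordval H g (?t n @ w) = wordval H g (lift_gword u @ ?t m)"
        using H.wordval_gword_eq[OF u(2) H(3)] resp by blast
      then have eq: "wordval H g (?t n) \<otimes>\<^bsub>H\<^esub> wordval H g w = wordval H g (lift_gword u) \<otimes>\<^bsub>H\<^esub> wordval H g (?t n)"
        using t w(1) lu True by (simp add: H.wordval_append[OF H(3)])
      \<comment> \<open>Were w trivial in \<open>H\<close>, cancelling t^n in the equation t^n w = u
        t^n would make \<open>u\<close> trivial there.\<close>
      have "wordval H g w \<noteq> \<one>\<^bsub>H\<^esub>"
        using eq H(5) H.wordval_closed[OF H(3) t[of n]] H.wordval_closed[OF H(3) lu] by auto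
      then show ?thesis
        using presented_group_separate[OF H(1,2,3) resp w(1)] by (simp add: G_def)
    qed
  qed
  then show ?thesis
    unfolding G residually_finite_def by (auto simp: G_def carrier_presented_group)
qed

end
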